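(* Let $\mathcal{X}$ be a curve over $\mathbb{F}_q$ given by an affine equation $f(y)=g(x)$, where $f(T),g(T)\in\mathbb{F}_q[T]$, $\deg f=a$, $\deg g=b$, $\gcd(a,b)=1$, and suppose that $\mathcal{X}$ is absolutely irreducible with genus $(a-1)(b-1)/2$. Suppose $a+1\le q$ and let $P_1,P_2,\ldots,P_{a+1}$ be $a+1$ distinct rational points on $\mathcal{X}$ such that $$aP_1\sim P_2+\cdots+P_{a+1}\qquad\text{and}\qquad bP_i\sim bP_j\ \text{ for all } i,j\in\{1,2,\ldots,a+1\}.$$ For $2\le m\le a+1$, let $$S_m=\Big\{(tb-ia,\ s_2b+i,\ \ldots,\ s_mb+i)\ :\ t,i,s_2,\ldots,s_m\in\mathbb{Z},\ t+\sum_{j=2}^m s_j=a+1-m,\ 0<ia<tb,\ s_j\ge 0\Big\}.$$ Then $\Gamma(P_1,\ldots,P_m)=S_m$.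
   Context: Here $\mathbb{F}_q$ is a finite field, and "curve" means a nonsingular, projective, geometrically irreducible algebraic curve of genus at least $1$ over $\mathbb{F}_q$; a curve given by an affine plane equation means the nonsingular projective curve with that plane model. $\sim$ denotes linear equivalence of divisors. $\mathbb{N}$ is the set of positive integers and $\mathbb{N}_0=\mathbb{N}\cup\{0\}$. For a rational function $h$, $(h)_\infty$ denotes its divisor of poles. For distinct rational points $P_1,\ldots,P_m$ on $\mathcal{X}$, the Weierstrass semigroup is $$H(P_1,\ldots,P_m)=\Big\{(a_1,\ldots,a_m)\in\mathbb{N}_0^m:\ \text{there is a rational function } h \text{ on } \mathcal{X} \text{ over } \mathbb{F}_q \text{ with } (h)_\infty=\sum_{i=1}^m a_iP_i\Big\}.$$ Let $\preceq$ be the partial order on $\mathbb{N}_0^m$ given by $(n_1,\ldots,n_m)\preceq(p_1,\ldots,p_m)$ iff $n_i\le p_i$ for all $i$. For $\mathbf{n}=(n_1,\ldots,n_m)\in\mathbb{N}_0^m$ and $i\in\{1,\ldots,m\}$, set $\nabla_i(\mathbf{n})=\{(p_1,\ldots,p_m)\in H(P_1,\ldots,P_m): p_i=n_i\}$. For $m\ge2$ define $$\Gamma(P_1,\ldots,P_m)=\{\mathbf{n}\in\mathbb{N}^m:\ \text{for some } i,\ 1\le i\le m,\ \mathbf{n}\text{ is minimal in }\nabla_i(\mathbf{n})\text{ with respect to }\preceq\},$$ where minimal includes that $\mathbf{n}\in\nabla_i(\mathbf{n})$. This set is called the minimal generating set of $H(P_1,\ldots,P_m)$. *)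

theory Defs
  imports
    "HOL-Algebra.Algebraic_Closure_Type"
    "HOL-Library.Poly_Mapping"
    "HOL-Library.FuncSet"
    "HOL-Library.Extended_Real"
    "Subresultants.More_Homomorphisms"
begin

text \<open>
  A nonsingular projective curve over \<open>k\<close> is handled through its function field, a field
  \<open>'f\<close> together with the embedding \<open>\<phi> :: 'k \<Rightarrow> 'f\<close> of the constants. Its closed points are the
  places of the function field, i.e. the normalised discrete valuations of \<open>'f\<close> that are
  trivial on the constants; the rational points are the places of degree one.
\<close>

subsection \<open>Places and divisors\<close>

text \<open>A place is represented by its order function \<open>ord\<^sub>P\<close>. The order of \<open>0\<close> is mathematically
  infinite; it is set to \<open>0\<close> so that every place is represented by exactly one function.\<close>

type_synonym 'f place = "'f \<Rightarrow> int"

definition places :: "('k::field \<Rightarrow> 'f::field) \<Rightarrow> 'f place set" where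
  "places \<phi> = {v. v 0 = 0 \<and>
     (\<forall>c. v (\<phi> c) = 0) \<and>
     (\<forall>z w. z \<noteq> 0 \<longrightarrow> w \<noteq> 0 \<longrightarrow> v (z * w) = v z + v w) \<and>
     (\<forall>z w. z \<noteq> 0 \<longrightarrow> w \<noteq> 0 \<longrightarrow> z + w \<noteq> 0 \<longrightarrow> v (z + w) \<ge> min (v z) (v w)) \<and>
     (\<exists>z. z \<noteq> 0 \<and> v z = 1)}"

definition local_ring :: "'f::field place \<Rightarrow> 'f set" where
  "local_ring v = {z. z = 0 \<or> v z \<ge> 0}"

definition maximal_ideal :: "'f::field place \<Rightarrow> 'f set" where
  "maximal_ideal v = {z. z = 0 \<or> v z > 0}"

text \<open>The degree of a place is the dimension over \<open>k\<close> of its residue field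
  \<open>local_ring v / maximal_ideal v\<close>. A finite set \<open>B\<close> represents a basis of this quotient if every
  element of the local ring is congruent, modulo the maximal ideal, to exactly one
  \<open>k\<close>-linear combination of \<open>B\<close>.\<close>

definition residue_basis :: "('k::field \<Rightarrow> 'f::field) \<Rightarrow> 'f place \<Rightarrow> 'f set \<Rightarrow> bool" where
  "residue_basis \<phi> v B \<longleftrightarrow> finite B \<and> B \<subseteq> local_ring v \<and>
     (\<forall>z\<in>local_ring v. \<exists>!c. c \<in> extensional B \<and> z - (\<Sum>u\<in>B. \<phi> (c u) * u) \<in> maximal_ideal v)"

definition place_degree :: "('k::field \<Rightarrow> 'f::field) \<Rightarrow> 'f place \<Rightarrow> nat" where
  "place_degree \<phi> v = (THE n. \<exists>B. residue_basis \<phi> v B \<and> card B = n)"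

definition rational_places :: "('k::field \<Rightarrow> 'f::field) \<Rightarrow> 'f place set" where
  "rational_places \<phi> = {v \<in> places \<phi>. place_degree \<phi> v = 1}"

definition divisors :: "('k::field \<Rightarrow> 'f::field) \<Rightarrow> ('f place \<Rightarrow>\<^sub>0 int) set" where
  "divisors \<phi> = {D. Poly_Mapping.keys D \<subseteq> places \<phi>}"

definition div_degree :: "('k::field \<Rightarrow> 'f::field) \<Rightarrow> ('f place \<Rightarrow>\<^sub>0 int) \<Rightarrow> int" where
  "div_degree \<phi> D = (\<Sum>v\<in>Poly_Mapping.keys D. Poly_Mapping.lookup D v * int (place_degree \<phi> v))"

text \<open>\<open>D = (h)\<close>, respectively \<open>D = (h)\<^sub>\<infinity>\<close>, for a nonzero function \<open>h\<close>.\<close>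

definition has_divisor :: "('k::field \<Rightarrow> 'f::field) \<Rightarrow> 'f \<Rightarrow> ('f place \<Rightarrow>\<^sub>0 int) \<Rightarrow> bool" where
  "has_divisor \<phi> h D \<longleftrightarrow> D \<in> divisors \<phi> \<and> (\<forall>v\<in>places \<phi>. Poly_Mapping.lookup D v = v h)"

definition has_pole_divisor :: "('k::field \<Rightarrow> 'f::field) \<Rightarrow> 'f \<Rightarrow> ('f place \<Rightarrow>\<^sub>0 int) \<Rightarrow> bool" where
  "has_pole_divisor \<phi> h D \<longleftrightarrow> D \<in> divisors \<phi> \<and> (\<forall>v\<in>places \<phi>. Poly_Mapping.lookup D v = max 0 (- v h))"

definition lin_equiv ::
    "('k::field \<Rightarrow> 'f::field) \<Rightarrow> ('f place \<Rightarrow>\<^sub>0 int) \<Rightarrow> ('f place \<Rightarrow>\<^sub>0 int) \<Rightarrow> bool" where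
  "lin_equiv \<phi> D E \<longleftrightarrow> (\<exists>h. h \<noteq> 0 \<and> has_divisor \<phi> h (D - E))"

subsection \<open>Genus\<close>

lemma vector_space_constants:
  assumes "field_hom (\<phi> :: 'k::field \<Rightarrow> 'f::field)"
  shows "vector_space (\<lambda>c z. \<phi> c * z)"
proof -
  interpret field_hom \<phi> by fact
  show ?thesis by unfold_locales (simp_all add: hom_distribs algebra_simps)
qed

definition riemann_roch_space ::
    "('k::field \<Rightarrow> 'f::field) \<Rightarrow> ('f place \<Rightarrow>\<^sub>0 int) \<Rightarrow> 'f set" where
  "riemann_roch_space \<phi> D = {h. h = 0 \<or> (\<forall>v\<in>places \<phi>. v h \<ge> - Poly_Mapping.lookup D v)}"

definition ell :: "('k::field \<Rightarrow> 'f::field) \<Rightarrow> ('f place \<Rightarrow>\<^sub>0 int) \<Rightarrow> nat" where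
  "ell \<phi> D = vector_space.dim (\<lambda>c z. \<phi> c * z) (riemann_roch_space \<phi> D)"

text \<open>The genus is the maximum of \<open>deg D - ell D + 1\<close> over all divisors \<open>D\<close>. It is taken as a
  supremum of extended reals, so that no a priori boundedness (Riemann's theorem) is needed
  for the definition to be meaningful.\<close>

definition genus :: "('k::field \<Rightarrow> 'f::field) \<Rightarrow> ereal" where
  "genus \<phi> = (SUP D\<in>divisors \<phi>. ereal (real_of_int (div_degree \<phi> D - int (ell \<phi> D) + 1)))"

subsection \<open>Plane models\<close>

text \<open>Bivariate polynomials are elements of \<open>k[X][Y]\<close>, i.e. of type \<open>'k poly poly\<close>, with \<open>Y\<close> the
  outer variable.\<close>

definition bipoly_eval :: "('k::field \<Rightarrow> 'f::field) \<Rightarrow> 'f \<Rightarrow> 'f \<Rightarrow> 'k poly poly \<Rightarrow> 'f" where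
  "bipoly_eval \<phi> x y p = poly (map_poly (\<lambda>c. poly (map_poly \<phi> c) x) p) y"

definition absolutely_irreducible :: "'k::field poly poly \<Rightarrow> bool" where
  "absolutely_irreducible p \<longleftrightarrow> irreducible (map_poly (map_poly to_ac) p)"

text \<open>\<open>'f\<close> is the fraction field of the coordinate ring \<open>k[X,Y] / (p)\<close>, with \<open>x\<close> and \<open>y\<close> the residue
  classes of \<open>X\<close> and \<open>Y\<close>.\<close>

definition is_function_field ::
    "('k::field \<Rightarrow> 'f::field) \<Rightarrow> 'f \<Rightarrow> 'f \<Rightarrow> 'k poly poly \<Rightarrow> bool" where
  "is_function_field \<phi> x y p \<longleftrightarrow> field_hom \<phi> \<and>
     (\<forall>r. bipoly_eval \<phi> x y r = 0 \<longleftrightarrow> p dvd r) \<and>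
     (\<forall>z. \<exists>r s. bipoly_eval \<phi> x y s \<noteq> 0 \<and> z = bipoly_eval \<phi> x y r / bipoly_eval \<phi> x y s)"

text \<open>\<open>f(Y) - g(X)\<close>\<close>

definition separated_poly :: "'k::field poly \<Rightarrow> 'k poly \<Rightarrow> 'k poly poly" where
  "separated_poly f g = map_poly (\<lambda>c. [:c:]) f - [:g:]"

subsection \<open>Weierstrass semigroups\<close>

text \<open>Tuples \<open>(a\<^sub>1, \<dots>, a\<^sub>m)\<close> are functions on \<open>{1..m}\<close> that are \<open>undefined\<close> elsewhere; the entries are
  integers, required to be nonnegative (positive) where the tuple ranges over \<open>\<nat>\<^sub>0\<^sup>m\<close> (\<open>\<nat>\<^sup>m\<close>).\<close>

definition weierstrass_semigroup ::
    "('k::field \<Rightarrow> 'f::field) \<Rightarrow> (nat \<Rightarrow> 'f place) \<Rightarrow> nat \<Rightarrow> (nat \<Rightarrow> int) set" where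
  "weierstrass_semigroup \<phi> P m = {n \<in> {1..m} \<rightarrow>\<^sub>E {0..}.
     \<exists>h. h \<noteq> 0 \<and> has_pole_divisor \<phi> h (\<Sum>i=1..m. frag_cmul (n i) (frag_of (P i)))}"

definition tuple_le :: "nat \<Rightarrow> (nat \<Rightarrow> int) \<Rightarrow> (nat \<Rightarrow> int) \<Rightarrow> bool" where
  "tuple_le m n p \<longleftrightarrow> (\<forall>i\<in>{1..m}. n i \<le> p i)"

definition nabla ::
    "('k::field \<Rightarrow> 'f::field) \<Rightarrow> (nat \<Rightarrow> 'f place) \<Rightarrow> nat \<Rightarrow> nat \<Rightarrow> (nat \<Rightarrow> int) \<Rightarrow> (nat \<Rightarrow> int) set" where
  "nabla \<phi> P m i n = {p \<in> weierstrass_semigroup \<phi> P m. p i = n i}"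

definition minimal_in :: "nat \<Rightarrow> (nat \<Rightarrow> int) \<Rightarrow> (nat \<Rightarrow> int) set \<Rightarrow> bool" where
  "minimal_in m n A \<longleftrightarrow> n \<in> A \<and> (\<forall>p\<in>A. tuple_le m p n \<longrightarrow> p = n)"

definition minimal_generating_set ::
    "('k::field \<Rightarrow> 'f::field) \<Rightarrow> (nat \<Rightarrow> 'f place) \<Rightarrow> nat \<Rightarrow> (nat \<Rightarrow> int) set" where
  "minimal_generating_set \<phi> P m =
     {n \<in> {1..m} \<rightarrow>\<^sub>E {1..}. \<exists>i\<in>{1..m}. minimal_in m n (nabla \<phi> P m i n)}"

definition S_set :: "nat \<Rightarrow> nat \<Rightarrow> nat \<Rightarrow> (nat \<Rightarrow> int) set" where
  "S_set a b m =
     {restrict (\<lambda>j. if j = 1 then t * int b - i * int a else s j * int b + i) {1..m} | t i s.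
        t + (\<Sum>j=2..m. s j) = int a + 1 - int m \<and>
        0 < i * int a \<and> i * int a < t * int b \<and> (\<forall>j\<in>{2..m}. s j \<ge> 0)}"

end

theory Submission
  imports Defs
begin

text \<open>
  The linear equivalences give functions \<open>F\<close> and \<open>u\<^sub>j\<close> with \<open>(F) = P\<^sub>2 + \<dots> + P\<^bsub>a+1\<^esub> - a P\<^sub>1\<close> and
  \<open>(u\<^sub>j) = b P\<^sub>j - b P\<^sub>1\<close>. Hence the semigroup of \<open>P\<^sub>1\<close> contains \<open>a\<close> and \<open>b\<close>, and as the genus equals the number
  of gaps of \<open>\<langle>a, b\<rangle>\<close>, it is \<open>\<langle>a, b\<rangle>\<close>. The tuples in \<open>S\<^sub>m\<close> are the pole orders of the products
  \<open>F powi (- i) * (\<Prod>j. u\<^sub>j powi e\<^sub>j)\<close>. Conversely, a function whose pole order at \<open>P\<^sub>1\<close> is \<open>t b - i a\<close> and at \<open>P\<^sub>j\<close>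
  at most \<open>n\<^sub>j\<close> satisfies \<open>\<Sum>j. \<lceil>(i - n\<^sub>j) / b\<rceil> \<le> t\<close>: otherwise its product with suitable powers of \<open>F\<close> and
  the \<open>u\<^sub>j\<close> has all its poles at \<open>P\<^sub>1\<close>, of order \<open>a (b - 1) - b \<tau>\<close> with \<open>\<tau> \<ge> 1\<close>, which is not in
  \<open>\<langle>a, b\<rangle>\<close>.

  All that is needed of the Riemann--Roch theory is \<open>\<ell>(D) = deg D + 1 - g\<close> for \<open>D\<close> of large degree. It follows
  from the definition of the genus as a supremum once residue fields are known to be finite, which is a
  consequence of the plane model.
\<close>

section \<open>Functions on a plane curve\<close>

locale const_field = field_hom \<phi> for \<phi> :: "'k::{field,finite} \<Rightarrow> 'f::field"
begin

sublocale cv: vector_space "\<lambda>c z. \<phi> c * z"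
  by (rule vector_space_constants) (rule field_hom_axioms)

lemma card_constants: "card (UNIV :: 'k set) > 1"
  using card_mono[of "UNIV :: 'k set" "{0, 1}"] by simp

lemma span_eq_lincombs:
  assumes "finite B"
  shows "cv.span B = (\<lambda>c. \<Sum>v\<in>B. \<phi> (c v) * v) ` (B \<rightarrow>\<^sub>E UNIV)"
proof -
  have "(\<Sum>v\<in>B. \<phi> (c v) * v) = (\<Sum>v\<in>B. \<phi> (restrict c B v) * v)" for c
    by (rule sum.cong) auto
  then show ?thesis
    unfolding cv.span_finite[OF assms] by (fastforce intro!: restrict_PiE)
qed

lemma finite_span: "finite B \<Longrightarrow> finite (cv.span B)"
  by (simp add: span_eq_lincombs finite_PiE)

lemma card_span_le:
  assumes "finite B"
  shows "card (cv.span B) \<le> card (UNIV :: 'k set) ^ card B"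
proof -
  have "card (cv.span B) \<le> card (B \<rightarrow>\<^sub>E (UNIV :: 'k set))"
    unfolding span_eq_lincombs[OF assms] by (rule card_image_le) (simp add: assms finite_PiE)
  then show ?thesis by (simp add: card_PiE assms)
qed

lemma card_span_independent:
  assumes "finite B" "cv.independent B"
  shows "card (cv.span B) = card (UNIV :: 'k set) ^ card B"
proof -
  have "inj_on (\<lambda>c. \<Sum>v\<in>B. \<phi> (c v) * v) (B \<rightarrow>\<^sub>E (UNIV :: 'k set))"
  proof (rule inj_onI)
    fix c d :: "'f \<Rightarrow> 'k"
    assume cd: "c \<in> B \<rightarrow>\<^sub>E UNIV" "d \<in> B \<rightarrow>\<^sub>E UNIV"
      and eq: "(\<Sum>v\<in>B. \<phi> (c v) * v) = (\<Sum>v\<in>B. \<phi> (d v) * v)"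
    have "(\<Sum>v\<in>B. \<phi> (c v - d v) * v) = 0"
      using eq by (simp add: hom_distribs left_diff_distrib sum_subtractf)
    then have "\<forall>v\<in>B. c v - d v = 0"
      using assms(2) unfolding cv.dependent_finite[OF assms(1)]
      by (auto dest: spec[of _ "\<lambda>v. c v - d v"])
    then show "c = d" using cd by (intro PiE_ext) auto
  qed
  then show ?thesis
    by (simp add: span_eq_lincombs assms card_image card_PiE)
qed

end

section \<open>A filtration of the coordinate ring and finite rank\<close>

locale plane_curve = const_field \<phi> for \<phi> :: "'k::{field,finite} \<Rightarrow> 'f::field" +
  fixes x y :: 'f and f g :: "'k poly"
  assumes curve: "is_function_field \<phi> x y (separated_poly f g)"
    and degree_f: "degree f > 0"
begin

text \<open>The monomials \<open>x\<^sup>i y\<^sup>j\<close> with \<open>j < deg f\<close> span the coordinate ring; the span of those with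
  \<open>i \<le> n\<close> is the \<open>n\<close>-th step of a filtration of it.\<close>

definition monomials :: "nat \<Rightarrow> 'f set" where
  "monomials n = (\<lambda>(i, j). x ^ i * y ^ j) ` ({..n} \<times> {..<degree f})"

definition filtr :: "nat \<Rightarrow> 'f set" where
  "filtr n = cv.span (monomials n)"

text \<open>Multipliers of the filtration compose with adding degrees, so the curve equation enters
  only through multiplication by \<open>y\<close>.\<close>

definition raises :: "nat \<Rightarrow> 'f set" where
  "raises d = {z. \<forall>n. \<forall>w\<in>filtr n. z * w \<in> filtr (n + d)}"

lemma curve_equation: "poly (map_poly \<phi> f) y = poly (map_poly \<phi> g) x"
proof -
  interpret mp: map_poly_comm_ring_hom \<phi> ..
  interpret ev: comm_ring_hom "\<lambda>c. poly (map_poly \<phi> c) x"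
    by unfold_locales (simp_all add: mp.hom_add mp.hom_mult)
  interpret em: map_poly_comm_ring_hom "\<lambda>c. poly (map_poly \<phi> c) x" ..
  have "bipoly_eval \<phi> x y (separated_poly f g) = 0"
    using curve by (simp add: is_function_field_def)
  moreover have "map_poly (\<lambda>c. poly (map_poly \<phi> c) x) (map_poly (\<lambda>c. [:c:]) f) = map_poly \<phi> f"
    by (subst map_poly_map_poly) (auto simp: o_def map_poly_pCons_hom)
  ultimately show ?thesis
    by (simp add: bipoly_eval_def separated_poly_def em.hom_minus Polynomial.map_poly_pCons)
qed

lemma finite_monomials: "finite (monomials n)"
  by (simp add: monomials_def)

lemma card_monomials: "card (monomials n) \<le> (n + 1) * degree f"
proof -
  have "card (monomials n) \<le> card ({..n} \<times> {..<degree f})"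
    unfolding monomials_def by (rule card_image_le) simp
  then show ?thesis by simp
qed

lemma filtr_mono: "m \<le> n \<Longrightarrow> filtr m \<subseteq> filtr n"
  unfolding filtr_def monomials_def by (intro cv.span_mono image_mono) auto

lemma monomial_in_filtr: "i \<le> n \<Longrightarrow> j < degree f \<Longrightarrow> x ^ i * y ^ j \<in> filtr n"
  unfolding filtr_def monomials_def by (intro cv.span_base) auto

lemma filtr_add: "z \<in> filtr n \<Longrightarrow> w \<in> filtr n \<Longrightarrow> z + w \<in> filtr n"
  and filtr_diff: "z \<in> filtr n \<Longrightarrow> w \<in> filtr n \<Longrightarrow> z - w \<in> filtr n"
  and filtr_scale: "z \<in> filtr n \<Longrightarrow> \<phi> c * z \<in> filtr n"
  and filtr_0: "0 \<in> filtr n"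
  and filtr_sum: "(\<And>i. i \<in> I \<Longrightarrow> h i \<in> filtr n) \<Longrightarrow> sum h I \<in> filtr n"
  unfolding filtr_def
  by (auto intro: cv.span_add cv.span_diff cv.span_scale cv.span_zero cv.span_sum)

lemma raisesI:
  assumes "\<And>n i j. i \<le> n \<Longrightarrow> j < degree f \<Longrightarrow> z * (x ^ i * y ^ j) \<in> filtr (n + d)"
  shows "z \<in> raises d"
  unfolding raises_def
proof safe
  fix n w assume "w \<in> filtr n"
  then have "w \<in> cv.span (monomials n)" by (simp add: filtr_def)
  then show "z * w \<in> filtr (n + d)"
  proof (induction rule: cv.span_induct_alt)
    case base
    show ?case by (simp add: filtr_0)
  next
    case (step c b w)
    have "z * b \<in> filtr (n + d)" using step(1) assms by (auto simp: monomials_def)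
    then have "\<phi> c * (z * b) + z * w \<in> filtr (n + d)"
      by (intro filtr_add filtr_scale step)
    then show ?case by (simp add: algebra_simps)
  qed
qed

lemma raisesD: "z \<in> raises d \<Longrightarrow> w \<in> filtr n \<Longrightarrow> z * w \<in> filtr (n + d)"
  by (simp add: raises_def)

lemma raises_mono: "d \<le> e \<Longrightarrow> raises d \<subseteq> raises e"
proof
  fix z assume "d \<le> e" "z \<in> raises d"
  then show "z \<in> raises e"
    unfolding raises_def using filtr_mono[of "n + d" "n + e" for n] by (simp add: subset_iff)
qed

lemma raises_const: "\<phi> c \<in> raises 0"
  by (auto simp: raises_def filtr_scale)

lemma raises_add: "z \<in> raises d \<Longrightarrow> w \<in> raises d \<Longrightarrow> z + w \<in> raises d"
  by (auto simp: raises_def distrib_right filtr_add)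

lemma raises_mult: "z \<in> raises d \<Longrightarrow> w \<in> raises e \<Longrightarrow> z * w \<in> raises (d + e)"
proof -
  assume zw: "z \<in> raises d" "w \<in> raises e"
  have "z * w * v \<in> filtr (n + (d + e))" if "v \<in> filtr n" for v n
    using raisesD[OF zw(1) raisesD[OF zw(2) that]] by (simp add: ac_simps)
  then show ?thesis by (simp add: raises_def)
qed

lemma raises_power: "z \<in> raises d \<Longrightarrow> z ^ n \<in> raises (n * d)"
proof (induction n)
  case 0
  show ?case using raises_const[of 1] by simp
next
  case (Suc n)
  then show ?case using raises_mult[of z d "z ^ n" "n * d"] by simp
qed

lemma raises_in_filtr:
  assumes "z \<in> raises d"
  shows "z \<in> filtr d"
  using raisesD[OF assms monomial_in_filtr[of 0 0 0]] degree_f by simp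

lemma raises_x: "x \<in> raises 1"
proof (rule raisesI)
  fix n i j :: nat assume "i \<le> n" "j < degree f"
  then have "x ^ Suc i * y ^ j \<in> filtr (n + 1)" by (intro monomial_in_filtr) auto
  then show "x * (x ^ i * y ^ j) \<in> filtr (n + 1)" by (simp add: mult.assoc)
qed

text \<open>The curve equation, solved for the top power of \<open>y\<close>, leaves powers of
  \<open>x\<close> up to \<open>degree g\<close> and lower powers of \<open>y\<close>, all of them
  in this step of the filtration.\<close>

lemma y_power_degree: "y ^ degree f \<in> filtr (degree g)"
proof -
  let ?l = "\<phi> (lead_coeff f)"
  have l: "?l \<noteq> 0" using degree_f by auto
  have "poly (map_poly \<phi> f) y = (\<Sum>i\<le>degree f. \<phi> (coeff f i) * y ^ i)"
    by (simp add: poly_altdef)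
  also have "\<dots> = (\<Sum>i<degree f. \<phi> (coeff f i) * y ^ i) + ?l * y ^ degree f"
    by (simp add: lessThan_Suc_atMost[symmetric])
  finally have "?l * y ^ degree f
      = (\<Sum>i\<le>degree g. \<phi> (coeff g i) * (x ^ i * y ^ 0)) - (\<Sum>i<degree f. \<phi> (coeff f i) * (x ^ 0 * y ^ i))"
    using curve_equation by (simp add: poly_altdef[of "map_poly \<phi> g"] algebra_simps)
  also have "\<dots> \<in> filtr (degree g)"
    using degree_f by (intro filtr_diff filtr_sum filtr_scale monomial_in_filtr) auto
  finally have "\<phi> (inverse (lead_coeff f)) * (?l * y ^ degree f) \<in> filtr (degree g)"
    by (rule filtr_scale)
  then show ?thesis using l by (simp add: hom_distribs flip: mult.assoc)
qed

lemma raises_y: "y \<in> raises (degree g)"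
proof (rule raisesI)
  fix n i j :: nat assume ij: "i \<le> n" "j < degree f"
  show "y * (x ^ i * y ^ j) \<in> filtr (n + degree g)"
  proof (cases "Suc j < degree f")
    case True
    then have "x ^ i * y ^ Suc j \<in> filtr (n + degree g)" using ij by (intro monomial_in_filtr) auto
    then show ?thesis by (simp add: algebra_simps)
  next
    case False
    then have "Suc j = degree f" using ij by simp
    then have eq: "y * (x ^ i * y ^ j) = x ^ i * y ^ degree f"
      by (simp add: mult.left_commute flip: power_Suc)
    have "x ^ i * y ^ degree f \<in> filtr (degree g + i * 1)"
      by (rule raisesD[OF raises_power[OF raises_x] y_power_degree])
    then show ?thesis
      unfolding eq by (rule subsetD[OF filtr_mono, rotated]) (use ij in simp)
  qed
qed

text \<open>Horner evaluation in both variables: the outer induction multiplies by \<open>y\<close>,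
  the inner one by \<open>x\<close>, and each multiplication adds a fixed degree.\<close>

lemma coordinate_ring_raises: "\<exists>d. bipoly_eval \<phi> x y p \<in> raises d"
proof (induction p)
  case 0
  show ?case using raises_const[of 0] by (auto simp: bipoly_eval_def)
next
  case (pCons c p)
  obtain d where d: "bipoly_eval \<phi> x y p \<in> raises d" using pCons by auto
  have "\<exists>e. poly (map_poly \<phi> c) x \<in> raises e"
  proof (induction c)
    case 0
    show ?case using raises_const[of 0] by auto
  next
    case (pCons c p)
    then obtain d where "poly (map_poly \<phi> p) x \<in> raises d" by auto
    from raises_mult[OF raises_x this] have "x * poly (map_poly \<phi> p) x \<in> raises (1 + d)" .
    then have "\<phi> c + x * poly (map_poly \<phi> p) x \<in> raises (1 + d)"
      using raises_const[of c] raises_mono[of 0 "1 + d"] by (intro raises_add) auto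
    then show ?case unfolding map_poly_pCons_hom by auto
  qed
  then obtain e where e: "poly (map_poly \<phi> c) x \<in> raises e" by auto
  have "poly (map_poly \<phi> c) x + y * bipoly_eval \<phi> x y p \<in> raises (e + (degree g + d))"
    using e raises_mult[OF raises_y d] raises_mono[of e "e + (degree g + d)"] raises_mono[of "degree g + d" "e + (degree g + d)"]
    by (intro raises_add) (simp_all add: subset_iff)
  moreover have "bipoly_eval \<phi> x y (pCons c p) = poly (map_poly \<phi> c) x + y * bipoly_eval \<phi> x y p"
    by (simp add: bipoly_eval_def Polynomial.map_poly_pCons[where f = "\<lambda>c. poly (map_poly \<phi> c) x"])
  ultimately show ?case by auto
qed

lemma fraction:
  obtains s d where "s \<noteq> 0" "s \<in> raises d" "z * s \<in> raises d"
proof -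
  obtain p r where r: "bipoly_eval \<phi> x y r \<noteq> 0" "z = bipoly_eval \<phi> x y p / bipoly_eval \<phi> x y r"
    using curve unfolding is_function_field_def by meson
  obtain d e where "bipoly_eval \<phi> x y r \<in> raises d" "bipoly_eval \<phi> x y p \<in> raises e"
    using coordinate_ring_raises by meson
  then have "bipoly_eval \<phi> x y r \<in> raises (d + e)" "bipoly_eval \<phi> x y p \<in> raises (d + e)"
    using raises_mono[of d "d + e"] raises_mono[of e "d + e"] by auto
  then show thesis using r by (intro that[of "bipoly_eval \<phi> x y r" "d + e"]) auto
qed

lemma common_denominator:
  fixes u :: "nat \<Rightarrow> 'f"
  shows "\<exists>s d. s \<noteq> 0 \<and> s \<in> raises d \<and> (\<forall>l<K. u l * s \<in> raises d)"
proof (induction K)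
  case 0
  show ?case using raises_const[of 1] by (intro exI[of _ 1] exI[of _ 0]) auto
next
  case (Suc K)
  then obtain s d where s: "s \<noteq> 0" "s \<in> raises d" "\<And>l. l < K \<Longrightarrow> u l * s \<in> raises d" by auto
  obtain r e where r: "r \<noteq> 0" "r \<in> raises e" "u K * r \<in> raises e" using fraction[of "u K"] by metis
  have "u l * (s * r) \<in> raises (d + e)" if "l < Suc K" for l
  proof (cases "l = K")
    case True
    then show ?thesis using raises_mult[OF s(2) r(3)] by (simp add: algebra_simps)
  next
    case False
    then show ?thesis using raises_mult[OF s(3)[of l] r(2)] that by (simp add: algebra_simps)
  qed
  then show ?case using s r raises_mult[OF s(2) r(2)]
    by (intro exI[of _ "s * r"] exI[of _ "d + e"]) auto
qed

text \<open>The function field has finite degree over \<open>k(t)\<close>, with the relations cleared of denominators: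
  pigeonhole between the coefficient families and a step of the filtration.\<close>

lemma finite_rank_over:
  fixes t :: 'f
  shows "\<exists>K. \<forall>u :: nat \<Rightarrow> 'f. \<exists>n c. (\<exists>l<K. \<exists>j\<le>n. c l j \<noteq> 0) \<and>
    (\<Sum>l<K. \<Sum>j\<le>n. \<phi> (c l j) * u l * t ^ j) = 0"
proof -
  obtain s d where s: "s \<noteq> 0" "s \<in> raises d" "t * s \<in> raises d" by (rule fraction)
  let ?a = "degree f"
  \<comment> \<open>The \<open>K * (n + 1)\<close> coefficients compete with a span of dimension at
    most \<open>(e + n * d + 1) * degree f\<close>, so \<open>K > degree f * d\<close> makes them
    win for large \<open>n\<close>. \<open>K\<close> depends on \<open>t\<close> only, while
    \<open>e\<close> and \<open>n\<close> depend on \<open>u\<close>.\<close>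
  define K where "K = ?a * d + 1"
  show ?thesis
  proof (rule exI[of _ K], rule allI)
    fix u :: "nat \<Rightarrow> 'f"
    obtain r e where r: "r \<noteq> 0" "\<And>l. l < K \<Longrightarrow> u l * r \<in> raises e"
      using common_denominator[of K u] by auto
    define n where "n = ?a * e + ?a"
    define I where "I = {..<K} \<times> {..n}"
    define A where "A = I \<rightarrow>\<^sub>E (UNIV :: 'k set)"
    define F where "F c = (\<Sum>(l, j)\<in>I. \<phi> (c (l, j)) * (u l * t ^ j * (r * s ^ n)))" for c :: "nat \<times> nat \<Rightarrow> 'k"
    have "u l * t ^ j * (r * s ^ n) \<in> filtr (e + n * d)" if "l < K" "j \<le> n" for l j
    proof -
      \<comment> \<open>Spreading \<open>s ^ n\<close> over the factors clears the denominator of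
        every \<open>t ^ j\<close>, at the same cost \<open>n * d\<close> for all
        \<open>j\<close>.\<close>
      have "(t * s) ^ j * s ^ (n - j) \<in> raises (j * d + (n - j) * d)"
        by (intro raises_mult raises_power s)
      then have "(u l * r) * ((t * s) ^ j * s ^ (n - j)) \<in> raises (e + (j * d + (n - j) * d))"
        using that r by (intro raises_mult[of "u l * r"]) auto
      moreover have "(t * s) ^ j * s ^ (n - j) = t ^ j * s ^ n"
        using that by (simp add: power_mult_distrib mult.assoc flip: power_add)
      moreover have "j * d + (n - j) * d = n * d" using that by (simp flip: distrib_right)
      ultimately have "(u l * r) * (t ^ j * s ^ n) \<in> filtr (e + n * d)"
        using raises_in_filtr by metis
      then show ?thesis by (simp add: algebra_simps)
    qed
    then have "F ` A \<subseteq> filtr (e + n * d)"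
      by (auto simp: F_def I_def intro!: filtr_sum filtr_scale)
    then have "card (F ` A) \<le> card (filtr (e + n * d))"
      unfolding filtr_def by (rule card_mono[rotated]) (simp add: finite_span finite_monomials)
    also have "\<dots> \<le> card (UNIV :: 'k set) ^ card (monomials (e + n * d))"
      unfolding filtr_def by (rule card_span_le) (rule finite_monomials)
    also have "\<dots> \<le> card (UNIV :: 'k set) ^ ((e + n * d + 1) * ?a)"
      using card_monomials card_constants
      by (intro power_increasing) auto
    also have "\<dots> < card (UNIV :: 'k set) ^ (K * (n + 1))"
    proof (rule power_strict_increasing)
      show "(e + n * d + 1) * ?a < K * (n + 1)" by (simp add: K_def n_def algebra_simps)
      show "1 < card (UNIV :: 'k set)" by (rule card_constants)
    qed
    also have "\<dots> = card A" by (simp add: A_def I_def card_PiE card_cartesian_product)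
    finally have "\<not> inj_on F A" by (rule pigeonhole)
    then obtain c c' where c: "c \<in> A" "c' \<in> A" "c \<noteq> c'" "F c = F c'" by (auto simp: inj_on_def)
    define b where "b l j = c (l, j) - c' (l, j)" for l j
    have "\<exists>p\<in>I. c p \<noteq> c' p" using c unfolding A_def by (meson PiE_ext)
    then have nz: "\<exists>l<K. \<exists>j\<le>n. b l j \<noteq> 0" by (auto simp: I_def b_def)
    have "(\<Sum>l<K. \<Sum>j\<le>n. \<phi> (b l j) * u l * t ^ j) * (r * s ^ n)
        = (\<Sum>(l, j)\<in>I. \<phi> (b l j) * u l * t ^ j) * (r * s ^ n)"
      by (simp add: I_def sum.cartesian_product)
    also have "\<dots> = F c - F c'"
      unfolding F_def sum_distrib_right sum_subtractf[symmetric]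
      by (rule sum.cong) (auto simp: b_def hom_distribs algebra_simps)
    finally have "(\<Sum>l<K. \<Sum>j\<le>n. \<phi> (b l j) * u l * t ^ j) = 0" using c s r by simp
    then show "\<exists>n c. (\<exists>l<K. \<exists>j\<le>n. c l j \<noteq> 0) \<and> (\<Sum>l<K. \<Sum>j\<le>n. \<phi> (c l j) * u l * t ^ j) = 0"
      using nz by blast
  qed
qed

end

section \<open>Places, residue fields and Riemann's theorem\<close>

text \<open>From here on the plane model enters only through this finite rank property.\<close>

locale function_field = const_field \<phi> for \<phi> :: "'k::{field,finite} \<Rightarrow> 'f::field" +
  assumes finite_rank: "\<And>t. \<exists>K. \<forall>u :: nat \<Rightarrow> 'f. \<exists>n c. (\<exists>l<K. \<exists>j\<le>n. c l j \<noteq> 0) \<and>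
    (\<Sum>l<K. \<Sum>j\<le>n. \<phi> (c l j) * u l * t ^ j) = 0"

sublocale plane_curve \<subseteq> function_field
  by unfold_locales (rule finite_rank_over)

context function_field
begin

lemma place_zero: "v \<in> places \<phi> \<Longrightarrow> v 0 = 0"
  and place_const: "v \<in> places \<phi> \<Longrightarrow> v (\<phi> c) = 0"
  and place_mult: "v \<in> places \<phi> \<Longrightarrow> z \<noteq> 0 \<Longrightarrow> w \<noteq> 0 \<Longrightarrow> v (z * w) = v z + v w"
  and place_add: "v \<in> places \<phi> \<Longrightarrow> z \<noteq> 0 \<Longrightarrow> w \<noteq> 0 \<Longrightarrow> z + w \<noteq> 0 \<Longrightarrow> v (z + w) \<ge> min (v z) (v w)"
  and place_uniformizer: "v \<in> places \<phi> \<Longrightarrow> \<exists>t. t \<noteq> 0 \<and> v t = 1"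
  unfolding places_def by auto

lemma place_one: "v \<in> places \<phi> \<Longrightarrow> v 1 = 0"
  using place_const[of v 1] by simp

lemma place_uminus:
  assumes "v \<in> places \<phi>"
  shows "v (- z) = v z"
proof (cases "z = 0")
  case False
  have "v (\<phi> (- 1) * z) = v (\<phi> (- 1)) + v z" using assms False by (intro place_mult) auto
  then show ?thesis using place_const[OF assms, of "- 1"] by simp
qed simp

lemma place_scale:
  assumes "v \<in> places \<phi>" "c \<noteq> 0"
  shows "v (\<phi> c * z) = v z"
proof (cases "z = 0")
  case False
  then show ?thesis using place_mult[of v "\<phi> c" z] place_const[of v c] assms by simp
qed simp

lemma place_inverse:
  assumes "v \<in> places \<phi>"
  shows "v (inverse z) = - v z"
proof (cases "z = 0")
  case False
  then show ?thesis
    using place_mult[of v z "inverse z"] place_one[of v] assms by simp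
qed (use place_zero assms in simp)

lemma place_power:
  assumes "v \<in> places \<phi>" "z \<noteq> 0"
  shows "v (z ^ n) = int n * v z"
  by (induction n) (use assms in \<open>auto simp: place_one place_mult algebra_simps\<close>)

lemma place_powi:
  assumes "v \<in> places \<phi>" "z \<noteq> 0"
  shows "v (z powi n) = n * v z"
  by (cases "n \<ge> 0") (use assms in \<open>auto simp: power_int_def place_power place_inverse\<close>)

lemma place_prod:
  assumes "v \<in> places \<phi>" "finite I" "\<And>i. i \<in> I \<Longrightarrow> h i \<noteq> 0"
  shows "v (prod h I) = (\<Sum>i\<in>I. v (h i))"
  using assms(2,3)
  by (induction I rule: finite_induct) (use assms(1) in \<open>auto simp: place_one place_mult\<close>)

text \<open>Writing \<open>z\<close> as \<open>(z + w) - w\<close> gives the inequality opposite to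
  the ultrametric one. \<open>w = 0\<close> is a separate case because of the convention
  \<open>v 0 = 0\<close>.\<close>

lemma place_add_less:
  assumes v: "v \<in> places \<phi>" and z: "z \<noteq> 0" and w: "w = 0 \<or> v z < v w"
  shows "z + w \<noteq> 0" "v (z + w) = v z"
proof -
  have "z + w \<noteq> 0 \<and> v (z + w) = v z"
  proof (cases "w = 0")
    case False
    then have w: "v z < v w" using w by simp
    have nz: "z + w \<noteq> 0"
    proof
      assume "z + w = 0"
      then have "z = - w" by (simp add: eq_neg_iff_add_eq_0)
      then show False using w place_uminus[OF v] by simp
    qed
    have "v (z + w) \<ge> v z" using place_add[OF v z False nz] w by simp
    moreover have "v z \<ge> min (v (z + w)) (v w)"
      using place_add[OF v nz, of "- w"] False z by (simp add: place_uminus v)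
    ultimately show ?thesis using w nz by auto
  qed (use z in simp)
  then show "z + w \<noteq> 0" "v (z + w) = v z" by auto
qed

text \<open>With the convention \<open>v 0 = 0\<close>, the zero function has to be singled out.\<close>

definition order_ge :: "'f place \<Rightarrow> int \<Rightarrow> 'f set" where
  "order_ge v n = {h. h = 0 \<or> v h \<ge> n}"

lemma order_ge_add: "v \<in> places \<phi> \<Longrightarrow> z \<in> order_ge v n \<Longrightarrow> w \<in> order_ge v n \<Longrightarrow> z + w \<in> order_ge v n"
  unfolding order_ge_def using place_add[of v z w] by fastforce

lemma order_ge_scale: "v \<in> places \<phi> \<Longrightarrow> z \<in> order_ge v n \<Longrightarrow> \<phi> c * z \<in> order_ge v n"
  unfolding order_ge_def using place_scale[of v c z] by (cases "c = 0") auto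

lemma order_ge_uminus: "v \<in> places \<phi> \<Longrightarrow> z \<in> order_ge v n \<Longrightarrow> - z \<in> order_ge v n"
  by (auto simp: order_ge_def place_uminus)

lemma order_ge_diff: "v \<in> places \<phi> \<Longrightarrow> z \<in> order_ge v n \<Longrightarrow> w \<in> order_ge v n \<Longrightarrow> z - w \<in> order_ge v n"
  using order_ge_add[of v z n "- w"] order_ge_uminus[of v w n] by simp

lemma order_ge_sum:
  "v \<in> places \<phi> \<Longrightarrow> (\<And>i. i \<in> I \<Longrightarrow> h i \<in> order_ge v n) \<Longrightarrow> sum h I \<in> order_ge v n"
  by (induction I rule: infinite_finite_induct) (simp_all add: order_ge_add, simp_all add: order_ge_def)

lemma order_ge_mult:
  "v \<in> places \<phi> \<Longrightarrow> z \<in> order_ge v m \<Longrightarrow> w \<in> order_ge v n \<Longrightarrow> z * w \<in> order_ge v (m + n)"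
  by (cases "z = 0 \<or> w = 0") (auto simp: order_ge_def place_mult)

section \<open>Residue fields and degrees of places\<close>

lemma local_ring_eq: "local_ring v = order_ge v 0"
  and maximal_ideal_eq: "maximal_ideal v = order_ge v 1"
  by (auto simp: local_ring_def maximal_ideal_def order_ge_def)

text \<open>Linear independence of residue classes over the constants, expressed on lifts so that no
  quotient has to be formed.\<close>

definition residue_independent :: "'f place \<Rightarrow> 'f set \<Rightarrow> bool" where
  "residue_independent v B \<longleftrightarrow> finite B \<and> B \<subseteq> local_ring v \<and>
     (\<forall>c. (\<Sum>u\<in>B. \<phi> (c u) * u) \<in> maximal_ideal v \<longrightarrow> (\<forall>u\<in>B. c u = 0))"

lemma residue_independentD:
  "residue_independent v B \<Longrightarrow> (\<Sum>u\<in>B. \<phi> (c u) * u) \<in> maximal_ideal v \<Longrightarrow> u \<in> B \<Longrightarrow> c u = 0"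
  by (simp add: residue_independent_def)

lemma residue_independent_subset:
  assumes "residue_independent v B" "A \<subseteq> B"
  shows "residue_independent v A"
proof -
  have fin: "finite B" using assms by (simp add: residue_independent_def)
  have "c u = 0" if c: "(\<Sum>u\<in>A. \<phi> (c u) * u) \<in> maximal_ideal v" and u: "u \<in> A" for c u
  proof -
    have "(\<Sum>u\<in>B. \<phi> (if u \<in> A then c u else 0) * u) = (\<Sum>u\<in>A. \<phi> (c u) * u)"
      using assms(2) fin by (intro sum.mono_neutral_cong_right) auto
    then have "(\<Sum>u\<in>B. \<phi> (if u \<in> A then c u else 0) * u) \<in> maximal_ideal v" using c by simp
    from residue_independentD[OF assms(1) this, of u] show ?thesis using assms(2) u by auto
  qed
  then show ?thesis using assms fin by (auto simp: residue_independent_def dest: finite_subset)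
qed

text \<open>Lifts of independent residues satisfy no relation over \<open>k[t]\<close>, \<open>t\<close> a uniformizer: the
  lowest coefficients would give a relation between the residues.\<close>

lemma residue_independent_powers:
  assumes v: "v \<in> places \<phi>" and t: "t \<noteq> 0" "v t = 1" and B: "residue_independent v B"
    and rel: "(\<Sum>j\<le>n. (\<Sum>u\<in>B. \<phi> (c j u) * u) * t ^ j) = 0"
  shows "\<forall>j\<le>n. \<forall>u\<in>B. c j u = 0"
  using rel
proof (induction n arbitrary: c)
  case 0
  then have "(\<Sum>u\<in>B. \<phi> (c 0 u) * u) \<in> maximal_ideal v" by (simp add: maximal_ideal_def)
  then show ?case using residue_independentD[OF B] by simp
next
  case (Suc n)
  let ?w = "\<lambda>j. \<Sum>u\<in>B. \<phi> (c j u) * u"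
  let ?r = "\<Sum>j\<le>n. ?w (Suc j) * t ^ j"
  \<comment> \<open>The term at \<open>j = 0\<close> is a multiple of \<open>t\<close>, so its
    residue vanishes and independence kills its coefficients; dividing by \<open>t\<close> leaves a
    shorter relation.\<close>
  have "?w 0 * t ^ 0 + (\<Sum>j\<le>n. ?w (Suc j) * t ^ Suc j) = 0"
    using Suc.prems by (subst (asm) sum.atMost_Suc_shift)
  also have "(\<Sum>j\<le>n. ?w (Suc j) * t ^ Suc j) = t * ?r"
    by (simp add: sum_distrib_left mult_ac)
  finally have eq: "?w 0 = - (t * ?r)" by (simp add: eq_neg_iff_add_eq_0)
  have w: "?w j \<in> order_ge v 0" for j
    using B v by (intro order_ge_sum order_ge_scale) (auto simp: residue_independent_def local_ring_eq)
  have "t ^ j \<in> order_ge v 0" for j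
    using t v by (simp add: order_ge_def place_power)
  then have "?w (Suc j) * t ^ j \<in> order_ge v (0 + 0)" for j
    by (rule order_ge_mult[OF v w])
  then have "?r \<in> order_ge v (0 + 0)" by (rule order_ge_sum[OF v])
  moreover have "t \<in> order_ge v 1" using t by (simp add: order_ge_def)
  ultimately have "t * ?r \<in> order_ge v 1" using v order_ge_mult[of v t 1 ?r 0] by simp
  then have "?w 0 \<in> maximal_ideal v"
    unfolding eq maximal_ideal_eq by (rule order_ge_uminus[OF v])
  then have c0: "c 0 u = 0" if "u \<in> B" for u using residue_independentD[OF B] that by simp
  then have "?w 0 = 0" by simp
  then have "?r = 0" using eq t by simp
  from Suc.IH[OF this] have c1: "\<forall>j\<le>n. \<forall>u\<in>B. c (Suc j) u = 0" .
  show ?case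
  proof (intro allI impI ballI)
    fix j u assume "j \<le> Suc n" "u \<in> B"
    then show "c j u = 0" using c0 c1 by (cases j) auto
  qed
qed

text \<open>\<open>finite_rank\<close> for a uniformizer \<open>t\<close> gives a nontrivial
  relation over polynomials in \<open>t\<close> among any \<open>K\<close> elements, which
  \<open>residue_independent_powers\<close> excludes for lifts of independent residues.\<close>

lemma residue_independent_bounded:
  assumes v: "v \<in> places \<phi>"
  shows "\<exists>K. \<forall>B. residue_independent v B \<longrightarrow> card B < K"
proof -
  obtain t where t: "t \<noteq> 0" "v t = 1" using place_uniformizer[OF v] by auto
  obtain K where K: "\<And>u :: nat \<Rightarrow> 'f. \<exists>n c. (\<exists>l<K. \<exists>j\<le>n. c l j \<noteq> 0) \<and>
    (\<Sum>l<K. \<Sum>j\<le>n. \<phi> (c l j) * u l * t ^ j) = 0" using finite_rank[of t] by auto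
  have "card B < K" if B: "residue_independent v B" for B
  proof (rule ccontr)
    assume "\<not> card B < K"
    then obtain A where A: "A \<subseteq> B" "card A = K"
      by (meson not_less obtain_subset_with_card_n)
    then have "finite A" using B by (auto simp: residue_independent_def dest: finite_subset)
    then obtain e where e: "bij_betw e {..<K} A"
      using A(2) ex_bij_betw_nat_finite[of A] by (auto simp: lessThan_atLeast0)
    obtain n c where c: "\<exists>l<K. \<exists>j\<le>n. c l j \<noteq> 0"
      and rel: "(\<Sum>l<K. \<Sum>j\<le>n. \<phi> (c l j) * e l * t ^ j) = 0" using K[of e] by auto
    define d where "d j u = c (the_inv_into {..<K} e u) j" for j u
    have d: "d j (e l) = c l j" if "l < K" for j l
      using that e by (simp add: d_def bij_betw_def the_inv_into_f_f)
    have "(\<Sum>u\<in>A. \<phi> (d j u) * u) = (\<Sum>l<K. \<phi> (c l j) * e l)" for j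
      by (subst sum.reindex_bij_betw[OF e, symmetric]) (simp add: d)
    then have "(\<Sum>j\<le>n. (\<Sum>u\<in>A. \<phi> (d j u) * u) * t ^ j) = (\<Sum>j\<le>n. \<Sum>l<K. \<phi> (c l j) * e l * t ^ j)"
      by (simp add: sum_distrib_right)
    also have "\<dots> = 0" using rel by (subst sum.swap)
    finally have z: "\<forall>j\<le>n. \<forall>u\<in>A. d j u = 0"
      by (rule residue_independent_powers[OF v t residue_independent_subset[OF B A(1)]])
    have "c l j = 0" if "l < K" "j \<le> n" for l j
      using z d[OF that(1), of j] that e by (auto dest: bij_betw_apply)
    then show False using c by auto
  qed
  then show ?thesis by auto
qed

lemma lincomb_diff:
  "(\<Sum>u\<in>B. \<phi> (c u - d u) * u) = (\<Sum>u\<in>B. \<phi> (c u) * u) - (\<Sum>u\<in>B. \<phi> (d u) * u)"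
  by (simp add: hom_distribs left_diff_distrib sum_subtractf)

lemma residue_basisI:
  assumes v: "v \<in> places \<phi>" and B: "residue_independent v B"
    and ex: "\<And>z. z \<in> local_ring v \<Longrightarrow> \<exists>c. z - (\<Sum>u\<in>B. \<phi> (c u) * u) \<in> maximal_ideal v"
  shows "residue_basis \<phi> v B"
proof -
  have "\<exists>!c. c \<in> extensional B \<and> z - (\<Sum>u\<in>B. \<phi> (c u) * u) \<in> maximal_ideal v"
    if z: "z \<in> local_ring v" for z
  proof -
    obtain c where c: "z - (\<Sum>u\<in>B. \<phi> (c u) * u) \<in> maximal_ideal v" using ex[OF z] by auto
    show ?thesis
    proof (rule ex1I[of _ "restrict c B"])
      show "restrict c B \<in> extensional B \<and> z - (\<Sum>u\<in>B. \<phi> (restrict c B u) * u) \<in> maximal_ideal v"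
        using c by simp
    next
      fix d assume d: "d \<in> extensional B \<and> z - (\<Sum>u\<in>B. \<phi> (d u) * u) \<in> maximal_ideal v"
      have "(z - (\<Sum>u\<in>B. \<phi> (c u) * u)) - (z - (\<Sum>u\<in>B. \<phi> (d u) * u)) \<in> maximal_ideal v"
        using c conjunct2[OF d] unfolding maximal_ideal_eq by (rule order_ge_diff[OF v])
      then have "(\<Sum>u\<in>B. \<phi> (d u - c u) * u) \<in> maximal_ideal v"
        unfolding lincomb_diff by (simp add: algebra_simps)
      from residue_independentD[OF B this] show "d = restrict c B"
        using d by (intro extensionalityI[of _ B]) auto
    qed
  qed
  then show ?thesis using B by (simp add: residue_basis_def residue_independent_def)
qed

text \<open>A residue-independent set of greatest cardinality, which exists by the bound, spans:
  adjoining a further element creates a relation that can be solved for it.\<close>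

lemma residue_basis_exists:
  assumes v: "v \<in> places \<phi>"
  obtains B where "residue_basis \<phi> v B"
proof -
  obtain K where K: "\<And>B. residue_independent v B \<Longrightarrow> card B < K"
    using residue_independent_bounded[OF v] by auto
  have "residue_independent v {}" by (simp add: residue_independent_def)
  then obtain B where B: "residue_independent v B"
      and max: "\<And>A. residue_independent v A \<Longrightarrow> card A \<le> card B"
    using ex_has_greatest_nat[of "residue_independent v" "{}" card K] K by (auto intro: less_imp_le)
  have fin: "finite B" and sub: "B \<subseteq> local_ring v"
    using B by (auto simp: residue_independent_def)
  have ex: "\<exists>c. z - (\<Sum>u\<in>B. \<phi> (c u) * u) \<in> maximal_ideal v" if z: "z \<in> local_ring v" for z
  proof (cases "z \<in> B")
    case True
    have "(\<Sum>u\<in>B. \<phi> (if u = z then 1 else 0) * u) = (\<Sum>u\<in>B. if u = z then z else 0)"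
      by (rule sum.cong) auto
    also have "\<dots> = z" using True fin by simp
    finally show ?thesis
      by (intro exI[of _ "\<lambda>u. if u = z then 1 else 0"]) (simp add: maximal_ideal_def)
  next
    case False
    have "\<not> residue_independent v (insert z B)"
      using max[of "insert z B"] False fin by auto
    then obtain c u where c: "(\<Sum>u\<in>insert z B. \<phi> (c u) * u) \<in> maximal_ideal v"
        and u: "u \<in> insert z B" "c u \<noteq> 0"
      using fin sub z unfolding residue_independent_def by auto
    have cz: "c z \<noteq> 0"
    proof
      assume cz: "c z = 0"
      then have "(\<Sum>u\<in>B. \<phi> (c u) * u) \<in> maximal_ideal v" using c fin False by simp
      from residue_independentD[OF B this, of u] show False using u cz by auto
    qed
    \<comment> \<open>The relation is normalised so that \<open>z\<close> has coefficient 1.\<close>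
    have "\<phi> (inverse (c z)) * (\<Sum>u\<in>insert z B. \<phi> (c u) * u) \<in> maximal_ideal v"
      using c unfolding maximal_ideal_eq by (rule order_ge_scale[OF v])
    also have "\<phi> (inverse (c z)) * (\<Sum>u\<in>insert z B. \<phi> (c u) * u)
        = z - (\<Sum>u\<in>B. \<phi> (- (c u / c z)) * u)"
      using fin False cz
      by (simp add: distrib_left sum_distrib_left hom_distribs sum_negf divide_inverse mult_ac)
    finally show ?thesis by (intro exI[of _ "\<lambda>u. - (c u / c z)"])
  qed
  show thesis by (rule that[OF residue_basisI[OF v B ex]])
qed

lemma residue_basis_unique:
  assumes "residue_basis \<phi> v B" "z \<in> local_ring v" "c \<in> extensional B" "d \<in> extensional B"
    "z - (\<Sum>u\<in>B. \<phi> (c u) * u) \<in> maximal_ideal v" "z - (\<Sum>u\<in>B. \<phi> (d u) * u) \<in> maximal_ideal v"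
  shows "c = d"
proof -
  have "\<exists>!c. c \<in> extensional B \<and> z - (\<Sum>u\<in>B. \<phi> (c u) * u) \<in> maximal_ideal v"
    using assms(1,2) by (simp add: residue_basis_def)
  from ex1_implies_ex[OF this] this assms(3-) show ?thesis by (auto elim!: ex1E)
qed

lemma residue_basis_coeffs:
  assumes "residue_basis \<phi> v B"
  obtains r where "\<And>z. z \<in> local_ring v \<Longrightarrow> r z \<in> B \<rightarrow>\<^sub>E UNIV"
    "\<And>z. z \<in> local_ring v \<Longrightarrow> z - (\<Sum>u\<in>B. \<phi> (r z u) * u) \<in> maximal_ideal v"
proof -
  have "\<forall>z\<in>local_ring v. \<exists>c. c \<in> extensional B \<and> z - (\<Sum>u\<in>B. \<phi> (c u) * u) \<in> maximal_ideal v"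
    using assms by (auto simp: residue_basis_def)
  from bchoice[OF this] obtain r where
    "\<forall>z\<in>local_ring v. r z \<in> extensional B \<and> z - (\<Sum>u\<in>B. \<phi> (r z u) * u) \<in> maximal_ideal v" ..
  then show thesis by (intro that[of r]) (auto simp: PiE_def)
qed

text \<open>Coefficient families on \<open>B\<close> inject into those on \<open>C\<close> by
  passing to the residue and expanding it in \<open>C\<close>; both sets of families are finite, and
  their cardinalities are powers of the same number.\<close>

lemma residue_basis_card_le:
  assumes v: "v \<in> places \<phi>" and B: "residue_basis \<phi> v B" and C: "residue_basis \<phi> v C"
  shows "card B \<le> card C"
proof -
  have fin: "finite B" "finite C" using B C by (auto simp: residue_basis_def)
  obtain r where r: "\<And>z. z \<in> local_ring v \<Longrightarrow> r z \<in> C \<rightarrow>\<^sub>E UNIV"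
    "\<And>z. z \<in> local_ring v \<Longrightarrow> z - (\<Sum>u\<in>C. \<phi> (r z u) * u) \<in> maximal_ideal v"
    using residue_basis_coeffs[OF C] by metis
  let ?s = "\<lambda>c. \<Sum>u\<in>B. \<phi> (c u) * u"
  have s: "?s c \<in> local_ring v" for c
    unfolding local_ring_eq using B v
    by (intro order_ge_sum order_ge_scale) (auto simp: residue_basis_def local_ring_eq)
  have "inj_on (\<lambda>c. r (?s c)) (B \<rightarrow>\<^sub>E UNIV)"
  proof (rule inj_onI)
    fix c d :: "'f \<Rightarrow> 'k" assume cd: "c \<in> B \<rightarrow>\<^sub>E UNIV" "d \<in> B \<rightarrow>\<^sub>E UNIV" and eq: "r (?s c) = r (?s d)"
    have "(?s c - (\<Sum>u\<in>C. \<phi> (r (?s c) u) * u)) - (?s d - (\<Sum>u\<in>C. \<phi> (r (?s d) u) * u)) \<in> maximal_ideal v"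
      using r(2)[OF s[of c]] r(2)[OF s[of d]] unfolding maximal_ideal_eq by (rule order_ge_diff[OF v])
    then have "?s c - ?s d \<in> maximal_ideal v" unfolding eq by simp
    moreover have "?s c - ?s c \<in> maximal_ideal v" by (simp add: maximal_ideal_def)
    ultimately show "c = d"
      using residue_basis_unique[OF B s[of c], of c d] cd by (simp add: PiE_def)
  qed
  then have "card (B \<rightarrow>\<^sub>E (UNIV :: 'k set)) \<le> card (C \<rightarrow>\<^sub>E (UNIV :: 'k set))"
  proof (rule card_inj_on_le)
    show "(\<lambda>c. r (?s c)) ` (B \<rightarrow>\<^sub>E UNIV) \<subseteq> C \<rightarrow>\<^sub>E UNIV" using r(1)[OF s] by blast
    show "finite (C \<rightarrow>\<^sub>E (UNIV :: 'k set))" using fin by (intro finite_PiE) auto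
  qed
  then show ?thesis using fin card_constants by (simp add: card_PiE)
qed

lemma place_degree_eq:
  assumes "v \<in> places \<phi>" "residue_basis \<phi> v B"
  shows "place_degree \<phi> v = card B"
  unfolding place_degree_def
  using assms by (intro the_equality) (auto intro: antisym residue_basis_card_le)

lemma place_degree_pos:
  assumes v: "v \<in> places \<phi>"
  shows "place_degree \<phi> v > 0"
proof -
  obtain B where B: "residue_basis \<phi> v B" using residue_basis_exists[OF v] .
  have one: "1 \<in> local_ring v" using place_one[OF v] by (simp add: local_ring_def)
  have "B \<noteq> {}"
  proof
    assume "B = {}"
    then have "1 \<in> maximal_ideal v"
      using B one unfolding residue_basis_def by auto
    then show False using place_one[OF v] by (simp add: maximal_ideal_def)
  qed
  then show ?thesis using B place_degree_eq[OF v B] by (simp add: residue_basis_def card_gt_0_iff)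
qed

text \<open>The leading coefficient at a place embeds a quotient of consecutive steps of the order
  filtration into the residue field.\<close>

lemma card_order_jump:
  assumes v: "v \<in> places \<phi>" and A: "finite A" "A \<subseteq> order_ge v n"
    and diff: "\<And>z w. z \<in> A \<Longrightarrow> w \<in> A \<Longrightarrow> z - w \<in> A"
  shows "card A \<le> card (UNIV :: 'k set) ^ place_degree \<phi> v * card (A \<inter> order_ge v (n + 1))"
proof -
  obtain B where B: "residue_basis \<phi> v B" using residue_basis_exists[OF v] .
  have fin: "finite B" using B by (simp add: residue_basis_def)
  obtain t where t: "t \<noteq> 0" "v t = 1" using place_uniformizer[OF v] by auto
  \<comment> \<open>Multiplication by \<open>s\<close> moves order \<open>n\<close> to order 0,
    where residues are defined.\<close>
  define s where "s = t powi (- n)"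
  have s: "s \<noteq> 0" "v s = - n" using t v by (simp_all add: s_def place_powi)
  have shift: "s * z \<in> order_ge v m \<longleftrightarrow> z \<in> order_ge v (m + n)" for z m
    using place_mult[OF v s(1), of z] s by (cases "z = 0") (auto simp: order_ge_def)
  obtain r where r: "\<And>z. z \<in> local_ring v \<Longrightarrow> r z \<in> B \<rightarrow>\<^sub>E UNIV"
    "\<And>z. z \<in> local_ring v \<Longrightarrow> z - (\<Sum>u\<in>B. \<phi> (r z u) * u) \<in> maximal_ideal v"
    using residue_basis_coeffs[OF B] by metis
  define lc where "lc z = r (s * z)" for z
  have loc: "s * z \<in> local_ring v" if "z \<in> A" for z
    using A(2) that unfolding local_ring_eq shift by auto
  have lc: "lc z \<in> B \<rightarrow>\<^sub>E UNIV" if "z \<in> A" for z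
    unfolding lc_def by (rule r(1)[OF loc[OF that]])
  have same: "z - w \<in> A \<inter> order_ge v (n + 1)" if "z \<in> A" "w \<in> A" "lc z = lc w" for z w
  proof -
    have "(s * z - (\<Sum>u\<in>B. \<phi> (lc z u) * u)) - (s * w - (\<Sum>u\<in>B. \<phi> (lc w u) * u)) \<in> maximal_ideal v"
      using r(2)[OF loc[OF that(1)]] r(2)[OF loc[OF that(2)]]
      unfolding maximal_ideal_eq lc_def by (rule order_ge_diff[OF v])
    then have "s * (z - w) \<in> order_ge v 1"
      unfolding that(3) by (simp add: maximal_ideal_eq right_diff_distrib)
    then show ?thesis using diff that(1,2) unfolding shift by (simp add: add.commute)
  qed
  \<comment> \<open>One representative in \<open>A\<close> for each leading coefficient. An element
    is then determined by its leading coefficient and its difference from the representative, which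
    has order at least \<open>n + 1\<close>.\<close>
  define p where "p c = (SOME z. z \<in> A \<and> lc z = c)" for c
  have p: "p (lc z) \<in> A \<and> lc (p (lc z)) = lc z" if "z \<in> A" for z
    unfolding p_def by (rule someI[of _ z]) (simp add: that)
  let ?F = "\<lambda>z. (lc z, z - p (lc z))"
  have "card A \<le> card ((B \<rightarrow>\<^sub>E (UNIV :: 'k set)) \<times> (A \<inter> order_ge v (n + 1)))"
  proof (rule card_inj_on_le[of ?F])
    show "inj_on ?F A" by (rule inj_onI) auto
    show "?F ` A \<subseteq> (B \<rightarrow>\<^sub>E (UNIV :: 'k set)) \<times> (A \<inter> order_ge v (n + 1))"
    proof (intro image_subsetI SigmaI)
      fix z assume z: "z \<in> A"
      show "lc z \<in> B \<rightarrow>\<^sub>E UNIV" by (rule lc[OF z])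
      show "z - p (lc z) \<in> A \<inter> order_ge v (n + 1)" using p[OF z] z by (intro same) auto
    qed
    show "finite ((B \<rightarrow>\<^sub>E (UNIV :: 'k set)) \<times> (A \<inter> order_ge v (n + 1)))"
      using A fin by (intro finite_cartesian_product finite_PiE) auto
  qed
  then show ?thesis
    using fin by (simp add: card_cartesian_product card_PiE place_degree_eq[OF v B])
qed

end

section \<open>Degrees of divisors\<close>

lemma div_degree_superset:
  assumes "finite K" "Poly_Mapping.keys D \<subseteq> K"
  shows "div_degree \<phi> D = (\<Sum>v\<in>K. Poly_Mapping.lookup D v * int (place_degree \<phi> v))"
  unfolding div_degree_def
  by (rule sum.mono_neutral_left) (use assms in \<open>auto simp: in_keys_iff\<close>)

lemma div_degree_add: "div_degree \<phi> (D + E) = div_degree \<phi> D + div_degree \<phi> E"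
proof -
  let ?K = "Poly_Mapping.keys D \<union> Poly_Mapping.keys E"
  have "Poly_Mapping.keys (D + E) \<subseteq> ?K" by (rule Poly_Mapping.keys_add)
  then show ?thesis
    by (simp add: div_degree_superset[of ?K] lookup_add distrib_right sum.distrib)
qed

lemma div_degree_cmul: "div_degree \<phi> (frag_cmul c D) = c * div_degree \<phi> D"
  by (subst div_degree_superset[of "Poly_Mapping.keys D"])
    (auto simp: keys_cmul div_degree_def sum_distrib_left mult.assoc)

lemma div_degree_diff: "div_degree \<phi> (D - E) = div_degree \<phi> D - div_degree \<phi> E"
  using div_degree_add[of \<phi> "D - E" E] by simp

lemma div_degree_of: "div_degree \<phi> (frag_of v) = int (place_degree \<phi> v)"
  by (simp add: div_degree_def)

lemma divisors_add: "D \<in> divisors \<phi> \<Longrightarrow> E \<in> divisors \<phi> \<Longrightarrow> D + E \<in> divisors \<phi>"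
  unfolding divisors_def using Poly_Mapping.keys_add[of D E] by auto

lemma divisors_diff: "D \<in> divisors \<phi> \<Longrightarrow> E \<in> divisors \<phi> \<Longrightarrow> D - E \<in> divisors \<phi>"
  by (auto simp: divisors_def in_keys_iff lookup_minus subset_iff) (metis diff_self)

lemma divisors_cmul: "D \<in> divisors \<phi> \<Longrightarrow> frag_cmul c D \<in> divisors \<phi>"
  by (auto simp: divisors_def)

lemma divisors_of: "v \<in> places \<phi> \<Longrightarrow> frag_of v \<in> divisors \<phi>"
  by (simp add: divisors_def)

lemma divisors_zero: "0 \<in> divisors \<phi>"
  by (simp add: divisors_def)

section \<open>Riemann-Roch spaces\<close>

context function_field
begin

lemma riemann_roch_space_iff:
  "h \<in> riemann_roch_space \<phi> D \<longleftrightarrow> (\<forall>v\<in>places \<phi>. h \<in> order_ge v (- Poly_Mapping.lookup D v))"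
  by (auto simp: riemann_roch_space_def order_ge_def)

lemma riemann_roch_space_diff:
  "z \<in> riemann_roch_space \<phi> D \<Longrightarrow> w \<in> riemann_roch_space \<phi> D \<Longrightarrow> z - w \<in> riemann_roch_space \<phi> D"
  by (simp add: riemann_roch_space_iff order_ge_diff)

lemma subspace_riemann_roch_space: "cv.subspace (riemann_roch_space \<phi> D)"
  unfolding cv.subspace_def
  by (auto simp: riemann_roch_space_iff intro: order_ge_add order_ge_scale) (simp add: order_ge_def)

lemma riemann_roch_basis:
  obtains B where "cv.independent B" "riemann_roch_space \<phi> D = cv.span B" "ell \<phi> D = card B"
proof -
  let ?L = "riemann_roch_space \<phi> D"
  obtain B where B: "B \<subseteq> ?L" "cv.independent B" "?L \<subseteq> cv.span B" "card B = cv.dim ?L"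
    by (rule cv.basis_exists)
  have "cv.span B \<subseteq> ?L" using B(1) subspace_riemann_roch_space by (rule cv.span_minimal)
  then show thesis using B by (intro that[of B]) (auto simp: ell_def)
qed

text \<open>The dimension of an infinite-dimensional space is \<open>0\<close> by convention.\<close>

lemma ell_infinite: "infinite (riemann_roch_space \<phi> D) \<Longrightarrow> ell \<phi> D = 0"
  by (rule riemann_roch_basis[of D]) (metis card.infinite finite_span)

lemma card_riemann_roch_space:
  assumes "finite (riemann_roch_space \<phi> D)"
  shows "card (riemann_roch_space \<phi> D) = card (UNIV :: 'k set) ^ ell \<phi> D"
proof -
  obtain B where B: "cv.independent B" "riemann_roch_space \<phi> D = cv.span B" "ell \<phi> D = card B"
    by (rule riemann_roch_basis)
  then have "finite B" using assms cv.span_superset[of B] by (metis finite_subset)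
  then show ?thesis using B by (simp add: card_span_independent)
qed

end

section \<open>Riemann's inequality and Riemann's theorem\<close>

locale finite_genus = function_field \<phi> for \<phi> :: "'k::{field,finite} \<Rightarrow> 'f::field" +
  fixes gen :: int and P0 :: "'f place"
  assumes genus_eq: "genus \<phi> = ereal (real_of_int gen)"
    and P0: "P0 \<in> places \<phi>" "place_degree \<phi> P0 = 1"
begin

lemma riemann_inequality:
  assumes "D \<in> divisors \<phi>"
  shows "int (ell \<phi> D) \<ge> div_degree \<phi> D + 1 - gen"
proof -
  have "ereal (real_of_int (div_degree \<phi> D - int (ell \<phi> D) + 1)) \<le> genus \<phi>"
    unfolding genus_def using assms by (intro SUP_upper)
  then have "real_of_int (div_degree \<phi> D - int (ell \<phi> D) + 1) \<le> real_of_int gen"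
    by (simp only: genus_eq ereal_less_eq)
  then show ?thesis by linarith
qed

text \<open>Adding a positive multiple of \<open>P0\<close> keeps an infinite space infinite, hence
  \<open>ell\<close> equal to 0 by convention, while for a large multiple the Riemann inequality
  forces it to be positive.\<close>

lemma finite_riemann_roch_space:
  assumes D: "D \<in> divisors \<phi>"
  shows "finite (riemann_roch_space \<phi> D)"
proof (rule ccontr)
  assume inf: "infinite (riemann_roch_space \<phi> D)"
  define n where "n = \<bar>gen\<bar> + \<bar>div_degree \<phi> D\<bar>"
  let ?E = "D + frag_cmul n (frag_of P0)"
  have E: "?E \<in> divisors \<phi>" by (intro divisors_add divisors_cmul divisors_of D P0)
  have "riemann_roch_space \<phi> D \<subseteq> riemann_roch_space \<phi> ?E"
    by (fastforce simp: riemann_roch_space_def lookup_add n_def)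
  then have "ell \<phi> ?E = 0" using inf by (intro ell_infinite) (auto dest: finite_subset)
  then show False
    using riemann_inequality[OF E] P0
    by (simp add: div_degree_add div_degree_cmul div_degree_of n_def)
qed

lemmas card_riemann_roch = card_riemann_roch_space[OF finite_riemann_roch_space]

lemma ell_le_mult:
  assumes D: "D \<in> divisors \<phi>" and E: "E \<in> divisors \<phi>" and h: "h \<noteq> 0"
    and sub: "\<And>z. z \<in> riemann_roch_space \<phi> D \<Longrightarrow> h * z \<in> riemann_roch_space \<phi> E"
  shows "ell \<phi> D \<le> ell \<phi> E"
proof -
  have "card (riemann_roch_space \<phi> D) \<le> card (riemann_roch_space \<phi> E)"
    by (rule card_inj_on_le[of "(*) h"])
      (use h sub finite_riemann_roch_space[OF E] in \<open>auto intro: inj_onI\<close>)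
  then show ?thesis using card_constants by (simp add: card_riemann_roch D E)
qed

lemma ell_less:
  assumes D: "D \<in> divisors \<phi>" and E: "E \<in> divisors \<phi>"
    and "riemann_roch_space \<phi> D \<subset> riemann_roch_space \<phi> E"
  shows "ell \<phi> D < ell \<phi> E"
proof -
  have "card (riemann_roch_space \<phi> D) < card (riemann_roch_space \<phi> E)"
    by (rule psubset_card_mono) (use assms finite_riemann_roch_space in auto)
  then show ?thesis using card_constants by (simp add: card_riemann_roch D E)
qed

text \<open>Inside L(D + v), the functions with order at least \<open>- D v\<close> at
  \<open>v\<close> form L(D), so \<open>card_order_jump\<close> bounds the quotient by the residue
  field.\<close>

lemma ell_add_place:
  assumes D: "D \<in> divisors \<phi>" and v: "v \<in> places \<phi>"
  shows "ell \<phi> (D + frag_of v) \<le> ell \<phi> D + place_degree \<phi> v"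
proof -
  let ?q = "card (UNIV :: 'k set)"
  let ?E = "D + frag_of v" and ?n = "- Poly_Mapping.lookup D v - 1"
  have E: "?E \<in> divisors \<phi>" by (intro divisors_add divisors_of D v)
  have "card (riemann_roch_space \<phi> ?E)
      \<le> ?q ^ place_degree \<phi> v * card (riemann_roch_space \<phi> ?E \<inter> order_ge v (?n + 1))"
  proof (rule card_order_jump[OF v finite_riemann_roch_space[OF E]])
    show "riemann_roch_space \<phi> ?E \<subseteq> order_ge v ?n"
      using v by (auto simp: riemann_roch_space_iff lookup_add dest!: bspec[of _ _ v])
  qed (rule riemann_roch_space_diff)
  also have "riemann_roch_space \<phi> ?E \<inter> order_ge v (?n + 1) = riemann_roch_space \<phi> D"
    using v by (auto simp: riemann_roch_space_iff lookup_add order_ge_def split: if_splits)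
      fastforce+
  finally have "?q ^ ell \<phi> ?E \<le> ?q ^ (ell \<phi> D + place_degree \<phi> v)"
    by (simp add: card_riemann_roch D E power_add mult.commute)
  then show ?thesis using card_constants by simp
qed

text \<open>If \<open>h \<in> L(D)\<close> with \<open>deg D < 0\<close>, then multiplication by \<open>h ^ n\<close> embeds \<open>L(- n D)\<close>, whose
  dimension is unbounded, into \<open>L(0)\<close>. This replaces the theorem that principal divisors have
  degree \<open>0\<close>.\<close>

lemma degree_nonneg:
  assumes D: "D \<in> divisors \<phi>" and h: "h \<noteq> 0" "h \<in> riemann_roch_space \<phi> D"
  shows "div_degree \<phi> D \<ge> 0"
proof (rule ccontr)
  assume neg: "\<not> div_degree \<phi> D \<ge> 0"
  \<comment> \<open>The degree of \<open>?E\<close> is at least \<open>n\<close>, so the Riemann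
    inequality gives \<open>ell ?E\<close> at least \<open>n + 1 - gen\<close>, which exceeds
    \<open>ell 0\<close>.\<close>
  define n where "n = nat \<bar>gen\<bar> + ell \<phi> 0"
  let ?E = "frag_cmul (- int n) D"
  have E: "?E \<in> divisors \<phi>" by (rule divisors_cmul[OF D])
  have "ell \<phi> ?E \<le> ell \<phi> 0"
  proof (rule ell_le_mult[OF E divisors_zero])
    show "h ^ n \<noteq> 0" using h by simp
    fix z assume z: "z \<in> riemann_roch_space \<phi> ?E"
    show "h ^ n * z \<in> riemann_roch_space \<phi> 0"
      unfolding riemann_roch_space_iff
    proof
      fix v assume v: "v \<in> places \<phi>"
      have "v h \<ge> - Poly_Mapping.lookup D v" using h v by (auto simp: riemann_roch_space_def)
      then have "int n * v h \<ge> int n * - Poly_Mapping.lookup D v" by (rule mult_left_mono) simp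
      then have "h ^ n \<in> order_ge v (- (int n * Poly_Mapping.lookup D v))"
        using h v by (simp add: order_ge_def place_power)
      moreover have "z \<in> order_ge v (int n * Poly_Mapping.lookup D v)"
        using z v by (simp add: riemann_roch_space_iff)
      ultimately have "h ^ n * z \<in> order_ge v (- (int n * Poly_Mapping.lookup D v) + int n * Poly_Mapping.lookup D v)"
        by (rule order_ge_mult[OF v])
      then show "h ^ n * z \<in> order_ge v (- Poly_Mapping.lookup 0 v)" by simp
    qed
  qed
  moreover have "div_degree \<phi> ?E \<ge> int n"
  proof -
    have "int n * 1 \<le> int n * - div_degree \<phi> D" using neg by (intro mult_left_mono) auto
    then show ?thesis by (simp add: div_degree_cmul)
  qed
  ultimately show False using riemann_inequality[OF E] by (simp add: n_def)
qed

text \<open>A + (h) is effective. Its places are removed one at a time, each lowering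
  \<open>ell\<close> by at most its degree; once A = - (h), multiplication by
  \<open>inverse h\<close> embeds L(A + Y) into L(Y). The induction terminates because
  \<open>degree_nonneg\<close> keeps the degree nonnegative.\<close>

lemma ell_le_add_degree:
  assumes A: "A \<in> divisors \<phi>" and h: "h \<noteq> 0" "h \<in> riemann_roch_space \<phi> A" and Y: "Y \<in> divisors \<phi>"
  shows "int (ell \<phi> (A + Y)) \<le> int (ell \<phi> Y) + div_degree \<phi> A"
  using A h(2)
proof (induction "nat (div_degree \<phi> A)" arbitrary: A rule: less_induct)
  case less
  show ?case
  proof (cases "\<exists>v\<in>places \<phi>. v h > - Poly_Mapping.lookup A v")
    case True
    then obtain v where v: "v \<in> places \<phi>" "v h > - Poly_Mapping.lookup A v" by auto
    let ?B = "A - frag_of v"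
    have B: "?B \<in> divisors \<phi>" by (intro divisors_diff divisors_of less.prems v)
    have hB: "h \<in> riemann_roch_space \<phi> ?B"
      using less.prems(2) v h by (auto simp: riemann_roch_space_def lookup_minus)
    have deg: "div_degree \<phi> ?B = div_degree \<phi> A - int (place_degree \<phi> v)"
      by (simp add: div_degree_diff div_degree_of)
    then have "nat (div_degree \<phi> ?B) < nat (div_degree \<phi> A)"
      using place_degree_pos[OF v(1)] degree_nonneg[OF B h(1) hB] by simp
    from less.hyps[OF this B hB]
    have "int (ell \<phi> (?B + Y)) \<le> int (ell \<phi> Y) + div_degree \<phi> ?B" .
    moreover have "ell \<phi> (?B + Y + frag_of v) \<le> ell \<phi> (?B + Y) + place_degree \<phi> v"
      by (intro ell_add_place divisors_add B Y v)
    moreover have "?B + Y + frag_of v = A + Y" by (simp add: algebra_simps)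
    ultimately show ?thesis using deg by simp
  next
    case False
    then have eq: "v h = - Poly_Mapping.lookup A v" if "v \<in> places \<phi>" for v
      using less.prems(2) h that by (force simp: riemann_roch_space_def)
    have "ell \<phi> (A + Y) \<le> ell \<phi> Y"
    proof (rule ell_le_mult)
      show "inverse h \<noteq> 0" using h by simp
      fix z assume z: "z \<in> riemann_roch_space \<phi> (A + Y)"
      show "inverse h * z \<in> riemann_roch_space \<phi> Y"
        unfolding riemann_roch_space_iff
      proof
        fix v assume v: "v \<in> places \<phi>"
        have "inverse h \<in> order_ge v (Poly_Mapping.lookup A v)"
          using v by (simp add: order_ge_def place_inverse eq)
        moreover have "z \<in> order_ge v (- Poly_Mapping.lookup A v - Poly_Mapping.lookup Y v)"
          using z v by (simp add: riemann_roch_space_iff lookup_add)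
        ultimately have "inverse h * z \<in> order_ge v (Poly_Mapping.lookup A v
            + (- Poly_Mapping.lookup A v - Poly_Mapping.lookup Y v))"
          by (rule order_ge_mult[OF v])
        then show "inverse h * z \<in> order_ge v (- Poly_Mapping.lookup Y v)" by simp
      qed
    qed (intro divisors_add less.prems Y)+
    then show ?thesis using degree_nonneg[OF less.prems(1) h(1) less.prems(2)] by simp
  qed
qed

theorem riemann_theorem:
  "\<exists>c. \<forall>D\<in>divisors \<phi>. div_degree \<phi> D \<ge> c \<longrightarrow> int (ell \<phi> D) = div_degree \<phi> D + 1 - gen"
proof -
  \<comment> \<open>The values under the supremum are integers, so one above \<open>gen - 1\<close>
    attains it.\<close>
  have "ereal (real_of_int gen - 1) < genus \<phi>" by (simp add: genus_eq)
  then obtain D0 where D0: "D0 \<in> divisors \<phi>"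
    and "ereal (real_of_int gen - 1) < ereal (real_of_int (div_degree \<phi> D0 - int (ell \<phi> D0) + 1))"
    unfolding genus_def less_SUP_iff by auto
  then have opt: "int (ell \<phi> D0) \<le> div_degree \<phi> D0 + 1 - gen"
    by (simp only: less_ereal.simps)
  have "int (ell \<phi> D) = div_degree \<phi> D + 1 - gen"
    if D: "D \<in> divisors \<phi>" and deg: "div_degree \<phi> D \<ge> div_degree \<phi> D0 + gen" for D
  proof -
    let ?A = "D - D0"
    have A: "?A \<in> divisors \<phi>" by (intro divisors_diff D D0)
    \<comment> \<open>\<open>?A\<close> has degree at least \<open>gen\<close>, so L(D - D0)
      contains a nonzero function, along which D can be compared with D0.\<close>
    have "ell \<phi> ?A \<noteq> 0"
      using riemann_inequality[OF A] deg by (simp add: div_degree_diff)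
    then have "card (riemann_roch_space \<phi> ?A) > 1"
      using card_constants one_less_power[of "card (UNIV :: 'k set)" "ell \<phi> ?A"]
      by (simp add: card_riemann_roch A)
    then have "\<not> riemann_roch_space \<phi> ?A \<subseteq> {0}"
      using card_mono[of "{0 :: 'f}" "riemann_roch_space \<phi> ?A"] by auto
    then obtain h where h: "h \<noteq> 0" "h \<in> riemann_roch_space \<phi> ?A" by auto
    have "int (ell \<phi> D) \<le> int (ell \<phi> D0) + div_degree \<phi> ?A"
      using ell_le_add_degree[OF A h D0] by simp
    then show ?thesis using riemann_inequality[OF D] opt by (simp add: div_degree_diff)
  qed
  then show ?thesis by blast
qed

end

section \<open>Two generators and the gaps at the first point\<close>

definition two_gen :: "int \<Rightarrow> int \<Rightarrow> int set" where
  "two_gen a b = {\<alpha> * a + \<beta> * b |\<alpha> \<beta>. 0 \<le> \<alpha> \<and> 0 \<le> \<beta>}"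

lemma coprime_representation:
  fixes a b z :: int
  assumes "coprime a b" "b > 0"
  obtains \<alpha> \<beta> where "z = \<alpha> * a + \<beta> * b" "0 \<le> \<alpha>" "\<alpha> < b"
proof -
  obtain u v where uv: "u * a + v * b = 1" using assms(1) by (metis bezout_int coprime_iff_gcd_eq_1)
  define \<alpha> k where "\<alpha> = (z * u) mod b" and "k = (z * u) div b"
  have "z = z * (u * a + v * b)" by (simp add: uv)
  also have "\<dots> = (z * u) * a + (z * v) * b" by (simp add: algebra_simps)
  also have "z * u = \<alpha> + b * k" by (simp add: \<alpha>_def k_def)
  finally have "z = \<alpha> * a + (k * a + z * v) * b" by (simp add: algebra_simps)
  then show thesis using assms(2) by (intro that[of \<alpha>]) (auto simp: \<alpha>_def)
qed

text \<open>With the coefficient of \<open>a\<close> normalised to \<open>0 <= \<alpha> < b\<close>,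
  membership is decided by the sign of the coefficient of \<open>b\<close>. Reflection sends
  (\<alpha>, \<beta>) to (b - 1 - \<alpha>, - 1 - \<beta>), which exchanges the two signs.\<close>

lemma two_gen_symmetric:
  fixes a b :: int
  assumes ab: "coprime a b" "a > 0" "b > 0"
  shows "a * b - a - b - z \<in> two_gen a b \<longleftrightarrow> z \<notin> two_gen a b"
proof -
  have canonical: "\<alpha> * a + \<beta> * b \<in> two_gen a b \<longleftrightarrow> 0 \<le> \<beta>" if \<alpha>: "0 \<le> \<alpha>" "\<alpha> < b" for \<alpha> \<beta>
  proof
    assume "\<alpha> * a + \<beta> * b \<in> two_gen a b"
    then obtain \<gamma> \<delta> where eq: "\<alpha> * a + \<beta> * b = \<gamma> * a + \<delta> * b" and nn: "0 \<le> \<gamma>" "0 \<le> \<delta>"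
      by (auto simp: two_gen_def)
    then have eq': "(\<gamma> - \<alpha>) * a = (\<beta> - \<delta>) * b" by (simp add: algebra_simps)
    then have "b dvd (\<gamma> - \<alpha>) * a" by simp
    then have "b dvd \<gamma> - \<alpha>" using ab(1) by (simp add: coprime_commute coprime_dvd_mult_left_iff)
    then obtain k where k: "\<gamma> - \<alpha> = b * k" by (auto elim: dvdE)
    then have "b * (- 1) < b * k" using \<alpha> nn by linarith
    then have "k \<ge> 0" using ab(3) by (simp only: mult_less_cancel_left_pos)
    then have "0 \<le> (\<beta> - \<delta>) * b" using ab k by (simp flip: eq')
    then show "0 \<le> \<beta>" using ab nn by (simp add: zero_le_mult_iff)
  qed (use \<alpha> in \<open>auto simp: two_gen_def\<close>)
  obtain \<alpha> \<beta> where z: "z = \<alpha> * a + \<beta> * b" "0 \<le> \<alpha>" "\<alpha> < b"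
    using coprime_representation[OF ab(1,3)] .
  have "a * b - a - b - z = (b - 1 - \<alpha>) * a + (- 1 - \<beta>) * b"
    by (simp add: z(1) algebra_simps)
  then show ?thesis
    using canonical[of "b - 1 - \<alpha>" "- 1 - \<beta>"] canonical[of \<alpha> \<beta>] z by auto
qed

lemma two_gen_nonneg: "a > 0 \<Longrightarrow> b > 0 \<Longrightarrow> z \<in> two_gen a b \<Longrightarrow> z \<ge> 0"
  by (auto simp: two_gen_def)

text \<open>Reflection at \<open>c = a * b - a - b\<close> matches the gaps with the elements of the
  semigroup in \<open>{0..c}\<close>, so exactly half of these \<open>c + 1\<close> numbers are
  gaps, and there are none above \<open>c\<close>.\<close>

lemma card_two_gen:
  fixes a b N :: int
  assumes ab: "coprime a b" "a > 0" "b > 0" and N: "N \<ge> a * b - a - b" "N \<ge> 0"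
  shows "2 * int (card (two_gen a b \<inter> {0..N})) = 2 * (N + 1) - (a - 1) * (b - 1)"
proof -
  let ?G = "two_gen a b"
  define c where "c = a * b - a - b"
  have c1: "c + 1 = (a - 1) * (b - 1)" by (simp add: c_def algebra_simps)
  then have c0: "c + 1 \<ge> 0" using ab by simp
  have upper: "z \<le> c" if "z \<notin> ?G" for z
    using two_gen_symmetric[OF ab, of z] two_gen_nonneg[OF ab(2,3), of "c - z"] that
    by (simp add: c_def)
  have reflect: "card ({0..M} - ?G) = card (?G \<inter> {0..c})" if "M \<ge> c" for M
  proof (rule bij_betw_same_card)
    show "bij_betw (\<lambda>z. c - z) ({0..M} - ?G) (?G \<inter> {0..c})"
      by (rule bij_betwI[of _ _ _ "\<lambda>z. c - z"])
        (use two_gen_symmetric[OF ab] upper that in \<open>auto simp flip: c_def\<close>)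
  qed
  have split: "card (?G \<inter> {0..M}) + card ({0..M} - ?G) = nat (M + 1)" for M
  proof -
    have "card ({0..M} \<inter> ?G) + card ({0..M} - ?G) = card {0..M}"
      by (rule card_Int_Diff[symmetric]) simp
    then show ?thesis by (simp add: Int_commute)
  qed
  show ?thesis using split[of c] split[of N] reflect[of c] reflect[of N] N c0 c1 by (simp add: c_def)
qed

section \<open>Functions with zeros and poles among the given points\<close>

locale separated_points = finite_genus \<phi> gen "P 1"
  for \<phi> :: "'k::{field,finite} \<Rightarrow> 'f::field" and gen and P :: "nat \<Rightarrow> 'f place" +
  fixes a b :: nat
  assumes a_pos: "a > 0" and b_pos: "b > 0" and coprime_ab: "coprime a b"
    and gen_eq: "2 * gen = (int a - 1) * (int b - 1)"
    and points: "\<And>i. i \<in> {1..a+1} \<Longrightarrow> P i \<in> rational_places \<phi>"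
    and distinct: "inj_on P {1..a+1}"
    and equiv_a: "lin_equiv \<phi> (frag_cmul (int a) (frag_of (P 1))) (\<Sum>j=2..a+1. frag_of (P j))"
    and equiv_b: "\<And>i j. i \<in> {1..a+1} \<Longrightarrow> j \<in> {1..a+1} \<Longrightarrow>
      lin_equiv \<phi> (frag_cmul (int b) (frag_of (P i))) (frag_cmul (int b) (frag_of (P j)))"
begin

declare One_nat_def [simp del]

lemma point_place: "i \<in> {1..a+1} \<Longrightarrow> P i \<in> places \<phi>"
  and point_degree: "i \<in> {1..a+1} \<Longrightarrow> place_degree \<phi> (P i) = 1"
  using points by (auto simp: rational_places_def)

lemma point_eq_iff: "i \<in> {1..a+1} \<Longrightarrow> j \<in> {1..a+1} \<Longrightarrow> P i = P j \<longleftrightarrow> i = j"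
  using distinct by (auto dest: inj_onD)

lemma lookup_point_sum:
  assumes "I \<subseteq> {1..a+1}"
  shows "i \<in> {1..a+1} \<Longrightarrow> Poly_Mapping.lookup (\<Sum>j\<in>I. frag_cmul (c j) (frag_of (P j))) (P i) = (if i \<in> I then c i else 0)"
    and "v \<notin> P ` I \<Longrightarrow> Poly_Mapping.lookup (\<Sum>j\<in>I. frag_cmul (c j) (frag_of (P j))) v = 0"
proof -
  have fin: "finite I" using assms by (rule finite_subset) simp
  assume i: "i \<in> {1..a+1}"
  have "Poly_Mapping.lookup (\<Sum>j\<in>I. frag_cmul (c j) (frag_of (P j))) (P i)
      = (\<Sum>j\<in>I. if j = i then c j else 0)"
    unfolding lookup_sum using assms i by (intro sum.cong) (auto simp: point_eq_iff subset_iff)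
  then show "Poly_Mapping.lookup (\<Sum>j\<in>I. frag_cmul (c j) (frag_of (P j))) (P i) = (if i \<in> I then c i else 0)"
    using fin by simp
next
  assume "v \<notin> P ` I"
  then show "Poly_Mapping.lookup (\<Sum>j\<in>I. frag_cmul (c j) (frag_of (P j))) v = 0"
    unfolding lookup_sum by (intro sum.neutral) auto
qed

lemma function_a:
  obtains F where "F \<noteq> 0" "P 1 F = - int a" "\<And>j. j \<in> {2..a+1} \<Longrightarrow> P j F = 1"
    "\<And>v. v \<in> places \<phi> - P ` {1..a+1} \<Longrightarrow> v F = 0"
proof -
  let ?D = "\<Sum>j=2..a+1. frag_cmul 1 (frag_of (P j))"
  obtain h where h: "h \<noteq> 0" "\<And>v. v \<in> places \<phi> \<Longrightarrow> v h = Poly_Mapping.lookup (frag_cmul (int a) (frag_of (P 1)) - ?D) v"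
    using equiv_a unfolding lin_equiv_def has_divisor_def by auto
  have sub: "{2..a+1} \<subseteq> {1..a+1}" by auto
  show thesis
  \<comment> \<open>The equivalence supplies a function with its zero at \<open>P 1\<close>; the
    inverse has the pole there.\<close>
  proof (rule that[of "inverse h"])
    show "inverse h \<noteq> 0" using h by simp
    show "P 1 (inverse h) = - int a"
      using h(2)[of "P 1"] lookup_point_sum(1)[OF sub, of 1 "\<lambda>_. 1"]
      by (simp add: point_place place_inverse lookup_minus)
    show "P j (inverse h) = 1" if "j \<in> {2..a+1}" for j
      using h(2)[of "P j"] lookup_point_sum(1)[OF sub, of j "\<lambda>_. 1"] that point_eq_iff[of j 1]
      by (simp add: point_place place_inverse lookup_minus)
    show "v (inverse h) = 0" if v: "v \<in> places \<phi> - P ` {1..a+1}" for v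
    proof -
      have "v \<noteq> P 1" "v \<notin> P ` {2..a+1}" using v by auto
      then show ?thesis
        using h(2)[of v] lookup_point_sum(2)[OF sub, of v "\<lambda>_. 1"] v
        by (simp add: place_inverse lookup_minus)
    qed
  qed
qed

lemma function_b:
  assumes j: "j \<in> {2..a+1}"
  shows "\<exists>u. u \<noteq> 0 \<and> P 1 u = - int b \<and> P j u = int b \<and> (\<forall>v\<in>places \<phi>. v \<noteq> P 1 \<longrightarrow> v \<noteq> P j \<longrightarrow> v u = 0)"
proof -
  have j': "j \<in> {1..a+1}" "P j \<noteq> P 1" using j point_eq_iff[of j 1] by auto
  obtain u where "u \<noteq> 0" "\<And>v. v \<in> places \<phi> \<Longrightarrow>
      v u = Poly_Mapping.lookup (frag_cmul (int b) (frag_of (P j)) - frag_cmul (int b) (frag_of (P 1))) v"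
    using equiv_b[OF j'(1), of 1] unfolding lin_equiv_def has_divisor_def by auto
  note u = this
  have "P 1 u = - int b" "P j u = int b"
    using u(2)[OF point_place[of 1]] u(2)[OF point_place[OF j'(1)]] j'(2) by (simp_all add: lookup_minus)
  moreover have "v u = 0" if "v \<in> places \<phi>" "v \<noteq> P 1" "v \<noteq> P j" for v
    using u(2)[OF that(1)] that by (simp add: lookup_minus)
  ultimately show ?thesis using u(1) by blast
qed

text \<open>The function is \<open>F powi (- i)\<close> times the product of the
  \<open>u j powi e j\<close>. With these signs the pole orders take the form t b - i a at
  \<open>P 1\<close>, t being the sum of the \<open>e j\<close>, and i - b e_j at
  \<open>P j\<close>.\<close>

lemma principal_function:
  fixes i :: int and e :: "nat \<Rightarrow> int"
  obtains h where "h \<noteq> 0" "P 1 h = i * int a - int b * (\<Sum>j=2..a+1. e j)"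
    "\<And>j. j \<in> {2..a+1} \<Longrightarrow> P j h = int b * e j - i"
    "\<And>v. v \<in> places \<phi> - P ` {1..a+1} \<Longrightarrow> v h = 0"
proof -
  obtain F where F: "F \<noteq> 0" "P 1 F = - int a" "\<And>j. j \<in> {2..a+1} \<Longrightarrow> P j F = 1"
    "\<And>v. v \<in> places \<phi> - P ` {1..a+1} \<Longrightarrow> v F = 0" using function_a by blast
  have "\<forall>j\<in>{2..a+1}. \<exists>u. u \<noteq> 0 \<and> P 1 u = - int b \<and> P j u = int b \<and>
      (\<forall>v\<in>places \<phi>. v \<noteq> P 1 \<longrightarrow> v \<noteq> P j \<longrightarrow> v u = 0)" using function_b by blast
  from bchoice[OF this] obtain u where u: "\<And>j. j \<in> {2..a+1} \<Longrightarrow> u j \<noteq> 0"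
    "\<And>j. j \<in> {2..a+1} \<Longrightarrow> P 1 (u j) = - int b" "\<And>j. j \<in> {2..a+1} \<Longrightarrow> P j (u j) = int b"
    "\<And>j v. j \<in> {2..a+1} \<Longrightarrow> v \<in> places \<phi> \<Longrightarrow> v \<noteq> P 1 \<Longrightarrow> v \<noteq> P j \<Longrightarrow> v (u j) = 0"
    by blast
  define h where "h = F powi (- i) * (\<Prod>j=2..a+1. u j powi e j)"
  have nz: "u j powi e j \<noteq> 0" if "j \<in> {2..a+1}" for j using u(1)[OF that] by simp
  have vh: "v h = - i * v F + (\<Sum>j=2..a+1. e j * v (u j))" if v: "v \<in> places \<phi>" for v
  proof -
    have "v h = v (F powi (- i)) + v (\<Prod>j=2..a+1. u j powi e j)"
      unfolding h_def using F nz by (intro place_mult[OF v]) auto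
    also have "v (\<Prod>j=2..a+1. u j powi e j) = (\<Sum>j=2..a+1. v (u j powi e j))"
      using nz by (intro place_prod[OF v]) auto
    also have "\<dots> = (\<Sum>j=2..a+1. e j * v (u j))"
      using u(1) by (intro sum.cong place_powi[OF v]) auto
    finally show ?thesis using F by (simp add: place_powi[OF v])
  qed
  show thesis
  proof (rule that[of h])
    show "h \<noteq> 0" using F nz by (auto simp: h_def)
    have "(\<Sum>j=2..a+1. e j * P 1 (u j)) = (\<Sum>j=2..a+1. - (int b * e j))"
      using u(2) by (intro sum.cong) auto
    then show "P 1 h = i * int a - int b * (\<Sum>j=2..a+1. e j)"
      using vh[of "P 1"] point_place[of 1] F(2) by (simp add: sum_negf sum_distrib_left)
  next
    fix j assume j: "j \<in> {2..a+1}"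
    then have j': "j \<in> {1..a+1}" by auto
    have "(\<Sum>k=2..a+1. e k * P j (u k)) = (\<Sum>k=2..a+1. if k = j then int b * e j else 0)"
      using j u(3,4) point_place[OF j'] point_eq_iff[OF j'] by (intro sum.cong) auto
    then show "P j h = int b * e j - i" using vh[OF point_place[OF j']] F(3)[OF j] j by simp
  next
    fix v assume v: "v \<in> places \<phi> - P ` {1..a+1}"
    have "(\<Sum>k=2..a+1. e k * v (u k)) = 0"
      using v by (intro sum.neutral ballI) (auto intro!: u(4))
    then show "v h = 0" using vh[of v] F(4)[OF v] v by simp
  qed
qed

section \<open>Pole numbers at the first point\<close>

definition pole_number :: "int \<Rightarrow> bool" where
  "pole_number n \<longleftrightarrow> (\<exists>h. h \<noteq> 0 \<and> P 1 h = - n \<and> (\<forall>v\<in>places \<phi>. v \<noteq> P 1 \<longrightarrow> v h \<ge> 0))"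

lemma pole_number_space:
  assumes "h \<noteq> 0" "P 1 h = - n" "\<forall>v\<in>places \<phi>. v \<noteq> P 1 \<longrightarrow> v h \<ge> 0"
  shows "h \<in> riemann_roch_space \<phi> (frag_cmul n (frag_of (P 1)))"
  using assms by (auto simp: riemann_roch_space_def)

lemma multiple_P1_divisor: "frag_cmul n (frag_of (P 1)) \<in> divisors \<phi>"
  by (intro divisors_cmul divisors_of P0)

lemma multiple_P1_degree: "div_degree \<phi> (frag_cmul n (frag_of (P 1))) = n"
  using P0 by (simp add: div_degree_cmul div_degree_of)

lemma pole_number_nonneg: "pole_number n \<Longrightarrow> n \<ge> 0"
  unfolding pole_number_def
  using degree_nonneg[OF multiple_P1_divisor _ pole_number_space] multiple_P1_degree by metis

text \<open>Each pole number \<open>n\<close> makes the step from L((n - 1) P 1) to L(n P 1) strict,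
  so the dimension counts them.\<close>

lemma card_pole_numbers_le:
  assumes "\<And>n. n \<in> W \<Longrightarrow> pole_number n" "W \<subseteq> {0..<int N}"
  shows "card W \<le> ell \<phi> (frag_cmul (int N - 1) (frag_of (P 1)))"
  using assms
proof (induction N arbitrary: W)
  case (Suc N)
  let ?L = "\<lambda>n. frag_cmul n (frag_of (P 1))"
  have fin: "finite W" using Suc.prems(2) by (rule finite_subset) simp
  have IH: "card (W - {int N}) \<le> ell \<phi> (?L (int N - 1))"
    using Suc.prems by (intro Suc.IH) auto
  have sub: "riemann_roch_space \<phi> (?L (int N - 1)) \<subseteq> riemann_roch_space \<phi> (?L (int N))"
    by (fastforce simp: riemann_roch_space_def)
  show ?case
  proof (cases "int N \<in> W")
    case True
    then obtain h where h: "h \<noteq> 0" "P 1 h = - int N" "\<forall>v\<in>places \<phi>. v \<noteq> P 1 \<longrightarrow> v h \<ge> 0"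
      using Suc.prems(1) unfolding pole_number_def by blast
    then have "h \<in> riemann_roch_space \<phi> (?L (int N))" by (rule pole_number_space)
    moreover have "h \<notin> riemann_roch_space \<phi> (?L (int N - 1))"
      using h P0 by (auto simp: riemann_roch_space_def)
    ultimately have "ell \<phi> (?L (int N - 1)) < ell \<phi> (?L (int N))"
      using sub by (intro ell_less multiple_P1_divisor) auto
    then show ?thesis using IH True fin by (simp add: card_Diff_singleton)
  next
    case False
    have "ell \<phi> (?L (int N - 1)) \<le> ell \<phi> (?L (int N))"
      using sub by (intro ell_le_mult[of _ _ 1] multiple_P1_divisor) auto
    then show ?thesis using IH False by simp
  qed
qed simp

lemma pole_number_two_gen:
  assumes "n \<in> two_gen (int a) (int b)"
  shows "pole_number n"
proof -
  obtain \<alpha> \<beta> where n: "n = \<alpha> * int a + \<beta> * int b" "0 \<le> \<alpha>" "0 \<le> \<beta>"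
    using assms by (auto simp: two_gen_def)
  \<comment> \<open>The function is F^\<alpha> u_2^\<beta>; the index 2 is available because
    \<open>a > 0\<close>.\<close>
  define e :: "nat \<Rightarrow> int" where "e j = (if j = 2 then \<beta> else 0)" for j
  have "(\<Sum>j=2..a+1. e j) = \<beta>" using a_pos by (simp add: e_def)
  moreover obtain h where h: "h \<noteq> 0" "P 1 h = - \<alpha> * int a - int b * (\<Sum>j=2..a+1. e j)"
    "\<And>j. j \<in> {2..a+1} \<Longrightarrow> P j h = int b * e j - - \<alpha>"
    "\<And>v. v \<in> places \<phi> - P ` {1..a+1} \<Longrightarrow> v h = 0"
    using principal_function[of "- \<alpha>" e] by blast
  ultimately have "P 1 h = - n" by (simp add: n)
  moreover have "v h \<ge> 0" if v: "v \<in> places \<phi>" "v \<noteq> P 1" for v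
  proof (cases "v \<in> P ` {1..a+1}")
    case True
    then obtain j where j: "j \<in> {1..a+1}" "v = P j" by auto
    then have "j \<noteq> 1" using v by auto
    then have "j \<in> {2..a+1}" using j by auto
    then show ?thesis using h(3) n j by (simp add: e_def)
  qed (use h(4)[of v] v in simp)
  ultimately show ?thesis using h(1) by (auto simp: pole_number_def)
qed

text \<open>For \<tau> > 0 the number reflects to (\<tau> - 1) b, hence lies outside the semigroup
  generated by \<open>a\<close> and \<open>b\<close>. That semigroup already accounts for the full
  dimension of L(N P 1) for large N, leaving no room for another pole number.\<close>

lemma gap:
  assumes "pole_number (int a * (int b - 1) - int b * \<tau>)"
  shows "\<tau> \<le> 0"
proof (rule ccontr)
  assume \<tau>: "\<not> \<tau> \<le> 0"
  let ?z = "int a * (int b - 1) - int b * \<tau>" and ?G = "two_gen (int a) (int b)"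
  have ab: "coprime (int a) (int b)" "int a > 0" "int b > 0"
    using a_pos b_pos coprime_ab by auto
  have "int a * int b - int a - int b - ?z = 0 * int a + (\<tau> - 1) * int b"
    by (simp add: algebra_simps)
  also have "\<dots> \<in> ?G" using \<tau> unfolding two_gen_def by fastforce
  finally have z: "?z \<notin> ?G" using two_gen_symmetric[OF ab] by blast
  obtain c where c: "\<And>D. D \<in> divisors \<phi> \<Longrightarrow> div_degree \<phi> D \<ge> c \<Longrightarrow> int (ell \<phi> D) = div_degree \<phi> D + 1 - gen"
    using riemann_theorem by blast
  \<comment> \<open>Large enough for Riemann's theorem, for \<open>?z\<close> to lie below
    \<open>N\<close>, and for \<open>card_two_gen\<close>.\<close>
  define N where "N = nat (max c (max ?z (int a * int b - int a - int b)))"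
  have N: "int N \<ge> c" "int N \<ge> ?z" "int N \<ge> int a * int b - int a - int b" by (auto simp: N_def)
  define W where "W = insert ?z (?G \<inter> {0..int N})"
  have "card W \<le> ell \<phi> (frag_cmul (int (Suc N) - 1) (frag_of (P 1)))"
    using assms pole_number_nonneg[OF assms] N(2) pole_number_two_gen
    by (intro card_pole_numbers_le) (auto simp: W_def)
  moreover have "int (ell \<phi> (frag_cmul (int (Suc N) - 1) (frag_of (P 1)))) = int N + 1 - gen"
    using c[OF multiple_P1_divisor, of "int N"] N(1) by (simp add: multiple_P1_degree)
  moreover have "card W = card (?G \<inter> {0..int N}) + 1" using z by (simp add: W_def)
  moreover have "int (card (?G \<inter> {0..int N})) = int N + 1 - gen"
    using card_two_gen[OF ab N(3)] gen_eq by simp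
  ultimately show False by linarith
qed

text \<open>Multiplication by \<open>F ^ (i + b - 1) * (\<Prod>j. u\<^sub>j powi (- e\<^sub>j))\<close>, where \<open>(F) = P\<^sub>2 + \<dots> + P\<^bsub>a+1\<^esub> - a P\<^sub>1\<close>,
  \<open>(u\<^sub>j) = b P\<^sub>j - b P\<^sub>1\<close> and \<open>e\<^sub>j = - ((n\<^sub>j - i) div b)\<close> is the ceiling of \<open>(i - n\<^sub>j) / b\<close>, moves all
  poles to \<open>P\<^sub>1\<close>, where the resulting pole order would be a gap if the bound failed.\<close>

lemma order_bound:
  fixes t i :: int and n :: "nat \<Rightarrow> int"
  assumes h: "h \<noteq> 0" "P 1 h = - (t * int b - i * int a)"
    "\<And>j. j \<in> {2..a+1} \<Longrightarrow> P j h \<ge> - n j"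
    "\<And>v. v \<in> places \<phi> - P ` {1..a+1} \<Longrightarrow> v h \<ge> 0"
  shows "(\<Sum>j=2..a+1. - ((n j - i) div int b)) \<le> t"
proof -
  define e where "e j = - ((n j - i) div int b)" for j
  let ?s = "\<Sum>j=2..a+1. e j" and ?i = "- (i + int b - 1)"
  obtain w where w: "w \<noteq> 0" "P 1 w = ?i * int a - int b * (\<Sum>j=2..a+1. - e j)"
    "\<And>j. j \<in> {2..a+1} \<Longrightarrow> P j w = int b * - e j - ?i"
    "\<And>v. v \<in> places \<phi> - P ` {1..a+1} \<Longrightarrow> v w = 0"
    using principal_function[of ?i "\<lambda>j. - e j"] by blast
  have mult: "v (h * w) = v h + v w" if "v \<in> places \<phi>" for v
    using that h(1) w(1) by (rule place_mult)
  have "P 1 (h * w) = - (int a * (int b - 1) - int b * (?s - t))"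
    using mult[OF P0(1)] h(2) w(2) by (simp add: sum_negf algebra_simps)
  moreover have "v (h * w) \<ge> 0" if v: "v \<in> places \<phi>" "v \<noteq> P 1" for v
  proof (cases "v \<in> P ` {1..a+1}")
    case True
    then obtain j where j: "j \<in> {1..a+1}" "v = P j" by auto
    then have "j \<noteq> 1" using v by auto
    then have j2: "j \<in> {2..a+1}" using j by auto
    \<comment> \<open>The surplus \<open>b - 1\<close> in the exponent of F absorbs the remainder,
      which is at most \<open>b - 1\<close>.\<close>
    have "(n j - i) mod int b < int b" using b_pos by simp
    moreover have "n j - i = int b * ((n j - i) div int b) + (n j - i) mod int b" by simp
    ultimately have "n j - i < int b * - e j + int b" unfolding e_def by linarith
    then show ?thesis using mult[OF v(1)] h(3)[OF j2] w(3)[OF j2] j(2) by simp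
  qed (use mult[OF v(1)] h(4)[of v] w(4)[of v] v in simp)
  ultimately have "pole_number (int a * (int b - 1) - int b * (?s - t))"
    using h(1) w(1) unfolding pole_number_def by (intro exI[of _ "h * w"]) auto
  from gap[OF this] show ?thesis by (simp add: e_def)
qed

end

section \<open>The minimal generating set\<close>

context function_field
begin

text \<open>The residue field is spanned by one class \<open>u\<close>, which need not be that of 1;
  the constant is the quotient of the coordinates of \<open>z\<close> and of 1.\<close>

lemma residue_constant:
  assumes v: "v \<in> places \<phi>" "place_degree \<phi> v = 1" and z: "z \<in> local_ring v"
  obtains c where "z - \<phi> c \<in> maximal_ideal v"
proof -
  obtain B where B: "residue_basis \<phi> v B" using residue_basis_exists[OF v(1)] .
  then have "card B = 1" using place_degree_eq[OF v(1) B] v(2) by simp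
  then obtain u where u: "B = {u}" by (auto simp: card_1_singleton_iff)
  obtain r where r: "\<And>z. z \<in> local_ring v \<Longrightarrow> z - \<phi> (r z u) * u \<in> maximal_ideal v"
    using residue_basis_coeffs[OF B] unfolding u by auto metis
  have "1 \<in> local_ring v" using place_one[OF v(1)] by (simp add: local_ring_def)
  note r1 = r[OF this]
  have d: "r 1 u \<noteq> 0"
  proof
    assume "r 1 u = 0"
    then show False using r1 place_one[OF v(1)] by (simp add: maximal_ideal_def)
  qed
  let ?c = "r z u / r 1 u"
  have "\<phi> ?c * (1 - \<phi> (r 1 u) * u) \<in> maximal_ideal v"
    using r1 unfolding maximal_ideal_eq by (rule order_ge_scale[OF v(1)])
  with r[OF z] have "(z - \<phi> (r z u) * u) - \<phi> ?c * (1 - \<phi> (r 1 u) * u) \<in> maximal_ideal v"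
    unfolding maximal_ideal_eq by (rule order_ge_diff[OF v(1)])
  also have "(z - \<phi> (r z u) * u) - \<phi> ?c * (1 - \<phi> (r 1 u) * u) = z - \<phi> ?c"
    using d by (simp add: hom_distribs field_simps)
  finally show thesis by (rule that)
qed

end

lemma tuple_leD: "tuple_le m p n \<Longrightarrow> j \<in> {1..m} \<Longrightarrow> p j \<le> n j"
  by (simp add: tuple_le_def)

context separated_points
begin

lemma weierstrass_semigroup_iff:
  assumes m: "m \<le> a + 1"
  shows "n \<in> weierstrass_semigroup \<phi> P m \<longleftrightarrow> n \<in> {1..m} \<rightarrow>\<^sub>E {0..} \<and>
    (\<exists>h. h \<noteq> 0 \<and> (\<forall>j\<in>{1..m}. n j = max 0 (- P j h)) \<and> (\<forall>v\<in>places \<phi> - P ` {1..m}. v h \<ge> 0))"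
proof -
  let ?D = "\<Sum>i=1..m. frag_cmul (n i) (frag_of (P i))"
  have sub: "{1..m} \<subseteq> {1..a+1}" using m by auto
  have D: "?D \<in> divisors \<phi>"
  proof -
    have "(\<Sum>i\<in>I. frag_cmul (n i) (frag_of (P i))) \<in> divisors \<phi>" if "I \<subseteq> {1..a+1}" for I
      using that
      by (induction I rule: infinite_finite_induct)
        (auto intro!: divisors_add divisors_cmul divisors_of point_place divisors_zero)
    then show ?thesis using sub by blast
  qed
  have "has_pole_divisor \<phi> h ?D \<longleftrightarrow>
      (\<forall>j\<in>{1..m}. n j = max 0 (- P j h)) \<and> (\<forall>v\<in>places \<phi> - P ` {1..m}. v h \<ge> 0)" for h
  proof -
    have max0: "0 = max 0 (- x) \<longleftrightarrow> x \<ge> 0" for x :: int by auto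
    have 1: "Poly_Mapping.lookup ?D (P j) = n j" if "j \<in> {1..m}" for j
      using lookup_point_sum(1)[OF sub, of j n] that sub by auto
    have 2: "Poly_Mapping.lookup ?D v = 0" if "v \<notin> P ` {1..m}" for v
      using lookup_point_sum(2)[OF sub that] .
    have "P ` {1..m} \<subseteq> places \<phi>" using point_place sub by blast
    then have 3: "(\<forall>v\<in>places \<phi>. Q v) \<longleftrightarrow> (\<forall>j\<in>{1..m}. Q (P j)) \<and> (\<forall>v\<in>places \<phi> - P ` {1..m}. Q v)" for Q
      by blast
    have "has_pole_divisor \<phi> h ?D \<longleftrightarrow> (\<forall>v\<in>places \<phi>. Poly_Mapping.lookup ?D v = max 0 (- v h))"
      using D by (simp add: has_pole_divisor_def)
    also have "\<dots> \<longleftrightarrow> (\<forall>j\<in>{1..m}. n j = max 0 (- P j h)) \<and>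
        (\<forall>v\<in>places \<phi> - P ` {1..m}. 0 = max 0 (- v h))"
      unfolding 3 using 1 2 by simp
    finally show ?thesis unfolding max0 .
  qed
  then show ?thesis by (simp add: weierstrass_semigroup_def)
qed

text \<open>Minimality does not depend on the coordinate: a smaller tuple \<open>p\<close> with the same \<open>k\<close>-th entry can be
  used to cancel the pole of a function for \<open>n\<close> at \<open>P\<^sub>k\<close>, without changing the pole at \<open>P\<^sub>i\<close>.\<close>

lemma minimal_in_nabla_transfer:
  assumes m: "m \<le> a + 1" and i: "i \<in> {1..m}" and k: "k \<in> {1..m}"
    and n: "n \<in> {1..m} \<rightarrow>\<^sub>E {1..}" and min: "minimal_in m n (nabla \<phi> P m i n)"
  shows "minimal_in m n (nabla \<phi> P m k n)"
proof -
  have sub: "{1..m} \<subseteq> {1..a+1}" using m by auto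
  have nH: "n \<in> weierstrass_semigroup \<phi> P m"
    and least: "\<And>p. p \<in> weierstrass_semigroup \<phi> P m \<Longrightarrow> p i = n i \<Longrightarrow> tuple_le m p n \<Longrightarrow> p = n"
    using min by (auto simp: minimal_in_def nabla_def)
  have pos: "n j \<ge> 1" if "j \<in> {1..m}" for j using n that by (auto simp: PiE_def Pi_def)
  have "p = n" if p: "p \<in> weierstrass_semigroup \<phi> P m" "p k = n k" "tuple_le m p n" for p
  proof (rule ccontr)
    assume "p \<noteq> n"
    then have pi: "p i < n i" using least[OF p(1) _ p(3)] tuple_leD[OF p(3) i] by fastforce
    obtain h where h: "h \<noteq> 0" "\<forall>j\<in>{1..m}. n j = max 0 (- P j h)" "\<forall>v\<in>places \<phi> - P ` {1..m}. v h \<ge> 0"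
      using nH weierstrass_semigroup_iff[OF m] by blast
    obtain g where g: "g \<noteq> 0" "\<forall>j\<in>{1..m}. p j = max 0 (- P j g)" "\<forall>v\<in>places \<phi> - P ` {1..m}. v g \<ge> 0"
      using p(1) weierstrass_semigroup_iff[OF m] by blast
    have hn: "P j h = - n j" if "j \<in> {1..m}" for j
      using h(2) pos[OF that] that by (auto simp: max_def split: if_splits)
    have gp: "P j g \<ge> - p j" if "j \<in> {1..m}" for j
      using g(2) that by (auto simp: max_def split: if_splits)
    have Pk: "P k \<in> places \<phi>" "place_degree \<phi> (P k) = 1"
      using k sub by (auto intro: point_place point_degree)
    have Pi: "P i \<in> places \<phi>" using i sub by (auto intro: point_place)
    have gk: "P k g = - n k"
      using g(2) p(2) pos[OF k] k by (auto simp: max_def split: if_splits)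
    have "P k (h * inverse g) = 0"
      using h(1) g(1) hn[OF k] gk by (simp add: place_mult Pk place_inverse)
    \<comment> \<open>\<open>h\<close> and \<open>g\<close> have the same pole order at
      \<open>P k\<close>, so a constant \<open>c\<close> cancels the leading terms there.\<close>
    then obtain c where c: "h * inverse g - \<phi> c \<in> order_ge (P k) 1"
      using residue_constant[OF Pk, of "h * inverse g"] by (auto simp: local_ring_def maximal_ideal_eq)
    define w where "w = h - \<phi> c * g"
    \<comment> \<open>At \<open>P i\<close> the pole of \<open>g\<close> is of smaller order, so
      subtracting a multiple of \<open>g\<close> preserves the order of \<open>h\<close>.\<close>
    have "- (\<phi> c * g) = 0 \<or> P i h < P i (- (\<phi> c * g))"
      using hn[OF i] gp[OF i] pi by (cases "c = 0") (auto simp: place_uminus Pi place_scale)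
    from place_add_less[OF Pi h(1) this] have w0: "w \<noteq> 0" and wi: "P i w = - n i"
      using hn[OF i] by (simp_all add: w_def)
    have wk: "P k w > - n k"
    proof -
      have "g \<in> order_ge (P k) (- n k)" using gk by (simp add: order_ge_def)
      from order_ge_mult[OF Pk(1) c this] have "(h * inverse g - \<phi> c) * g \<in> order_ge (P k) (1 - n k)"
        by simp
      also have "(h * inverse g - \<phi> c) * g = w"
        using g(1) by (simp add: w_def left_diff_distrib)
      finally show ?thesis using w0 by (simp add: order_ge_def)
    qed
    have bound: "v w \<ge> r" if "v \<in> places \<phi>" "v h \<ge> r" "v g \<ge> r" for v r
    proof -
      have "w \<in> order_ge v r"
        unfolding w_def using that by (intro order_ge_diff order_ge_scale) (auto simp: order_ge_def)
      then show ?thesis using w0 by (simp add: order_ge_def)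
    qed
    have wj: "P j w \<ge> - n j" if "j \<in> {1..m}" for j
    proof (rule bound)
      have "p j \<le> n j" using p(3) that by (rule tuple_leD)
      then show "P j g \<ge> - n j" using gp[OF that] by linarith
      show "P j \<in> places \<phi>" using that sub by (intro point_place) blast
      show "P j h \<ge> - n j" using hn[OF that] by simp
    qed
    define p' where "p' = restrict (\<lambda>j. max 0 (- P j w)) {1..m}"
    have "p' \<in> weierstrass_semigroup \<phi> P m"
      unfolding weierstrass_semigroup_iff[OF m]
    proof (intro conjI exI[of _ w])
      show "\<forall>v\<in>places \<phi> - P ` {1..m}. 0 \<le> v w" using h(3) g(3) by (blast intro: bound)
    qed (auto simp: p'_def w0)
    moreover have "p' i = n i" using wi pos[OF i] i by (simp add: p'_def)
    moreover have "tuple_le m p' n"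
      using wj pos by (force simp: tuple_le_def p'_def)
    ultimately have "p' = n" by (rule least)
    moreover have "p' k < n k" using wk pos[OF k] k by (simp add: p'_def)
    ultimately show False by simp
  qed
  then show ?thesis using nH by (auto simp: minimal_in_def nabla_def)
qed

text \<open>The points beyond the first \<open>m\<close> carry exponent 1 each; they are the source
  of the constant a + 1 - m in the description of S_m.\<close>

lemma split_points_sum:
  assumes "2 \<le> m" "m \<le> a + 1" "\<And>j. j \<in> {m+1..a+1} \<Longrightarrow> e j = (1 :: int)"
  shows "(\<Sum>j=2..a+1. e j) = (\<Sum>j=2..m. e j) + (int a + 1 - int m)"
proof -
  have "(\<Sum>j=2..a+1. e j) = (\<Sum>j=2..m. e j) + (\<Sum>j=m+1..a+1. e j)"
    using assms(1,2) by (subst sum.union_disjoint[symmetric]) (auto intro!: sum.cong)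
  also have "(\<Sum>j=m+1..a+1. e j) = (\<Sum>j=m+1..a+1. 1)"
    using assms(3) by (intro sum.cong) auto
  also have "\<dots> = int a + 1 - int m" using assms(2) by (simp add: of_nat_diff)
  finally show ?thesis .
qed

text \<open>\<open>order_bound\<close> with pole bound 0 at the points beyond \<open>m\<close>,
  where the ceiling of i / b is 1 since 0 < i <= b.\<close>

lemma semigroup_order_bound:
  fixes t i :: int
  assumes m: "2 \<le> m" "m \<le> a + 1" and p: "p \<in> weierstrass_semigroup \<phi> P m"
    and p1: "p 1 = t * int b - i * int a" "p 1 > 0" and i: "0 < i" "i \<le> int b"
  shows "(\<Sum>j=2..m. - ((p j - i) div int b)) + (int a + 1 - int m) \<le> t"
proof -
  obtain h where h: "h \<noteq> 0" "\<forall>j\<in>{1..m}. p j = max 0 (- P j h)" "\<forall>v\<in>places \<phi> - P ` {1..m}. v h \<ge> 0"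
    using p weierstrass_semigroup_iff[OF m(2)] by blast
  define n where "n j = (if j \<le> m then p j else 0)" for j
  have "(\<Sum>j=2..a+1. - ((n j - i) div int b)) \<le> t"
  proof (rule order_bound)
    show "P 1 h = - (t * int b - i * int a)"
      using h(2) p1 m by (auto simp: max_def split: if_splits)
  next
    fix j assume j: "j \<in> {2..a+1}"
    show "P j h \<ge> - n j"
    proof (cases "j \<le> m")
      case True
      then show ?thesis using h(2) j by (auto simp: n_def max_def split: if_splits)
    next
      case False
      then have "P j \<in> places \<phi> - P ` {1..m}"
        using j m by (auto simp: point_place point_eq_iff)
      then show ?thesis using h(3) False by (simp add: n_def)
    qed
  next
    fix v assume "v \<in> places \<phi> - P ` {1..a+1}"
    then show "v h \<ge> 0" using h(3) m by auto
  qed (rule h(1))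
  also have "(\<Sum>j=2..a+1. - ((n j - i) div int b))
      = (\<Sum>j=2..m. - ((n j - i) div int b)) + (int a + 1 - int m)"
  proof (rule split_points_sum[OF m])
    fix j assume "j \<in> {m+1..a+1}"
    then have "n j = 0" by (simp add: n_def)
    moreover have "(- i) div int b = - 1"
      using i by (intro int_div_pos_eq[of _ _ _ "int b - i"]) auto
    ultimately show "- ((n j - i) div int b) = 1" by simp
  qed
  also have "(\<Sum>j=2..m. - ((n j - i) div int b)) = (\<Sum>j=2..m. - ((p j - i) div int b))"
    by (intro sum.cong) (auto simp: n_def)
  finally show ?thesis .
qed

text \<open>At the points beyond \<open>m\<close> the order is b - i, which is nonnegative, so no
  poles arise there.\<close>

lemma principal_tuple:
  fixes t i :: int and e :: "nat \<Rightarrow> int"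
  assumes m: "2 \<le> m" "m \<le> a + 1" and i: "i \<le> int b" and e: "\<And>j. j \<in> {m+1..a+1} \<Longrightarrow> e j = 1"
    and t: "(\<Sum>j=2..a+1. e j) = t" and pos: "i * int a \<le> t * int b"
  shows "restrict (\<lambda>j. if j = 1 then t * int b - i * int a else max 0 (i - int b * e j)) {1..m}
    \<in> weierstrass_semigroup \<phi> P m"
proof -
  obtain h where h: "h \<noteq> 0" "P 1 h = i * int a - int b * (\<Sum>j=2..a+1. e j)"
    "\<And>j. j \<in> {2..a+1} \<Longrightarrow> P j h = int b * e j - i"
    "\<And>v. v \<in> places \<phi> - P ` {1..a+1} \<Longrightarrow> v h = 0"
    using principal_function[of i e] by blast
  show ?thesis
    unfolding weierstrass_semigroup_iff[OF m(2)]
  proof (intro conjI exI[of _ h] ballI)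
    fix j assume j: "j \<in> {1..m}"
    show "restrict (\<lambda>j. if j = 1 then t * int b - i * int a else max 0 (i - int b * e j)) {1..m} j
        = max 0 (- P j h)"
      using j m h(2) h(3)[of j] t pos by (cases "j = 1") (auto simp: mult.commute)
  next
    fix v assume v: "v \<in> places \<phi> - P ` {1..m}"
    show "0 \<le> v h"
    proof (cases "v \<in> P ` {1..a+1}")
      case True
      then obtain j where j: "j \<in> {1..a+1}" "v = P j" by auto
      then have "j \<in> {m+1..a+1}" using v by force
      then show ?thesis using h(3)[of j] e[of j] j m i by simp
    qed (use h(4)[of v] v in simp)
  qed (use h(1) pos in auto)
qed

text \<open>Minimality is shown at coordinate 1. For \<open>p\<close> below \<open>n\<close> with
  the same first entry, the floors of (p_j - i) / b are at most s_j, while the order bound makes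
  their sum at least that of the s_j. So they are equal, and p_j >= s_j b + i = n_j.\<close>

lemma S_set_subset:
  assumes m: "2 \<le> m" "m \<le> a + 1" and n: "n \<in> S_set a b m"
  shows "n \<in> minimal_generating_set \<phi> P m"
proof -
  obtain t i :: int and s :: "nat \<Rightarrow> int" where
    n_eq: "n = restrict (\<lambda>j. if j = 1 then t * int b - i * int a else s j * int b + i) {1..m}"
    and ts: "t + (\<Sum>j=2..m. s j) = int a + 1 - int m"
    and ia: "0 < i * int a" "i * int a < t * int b" and s: "\<forall>j\<in>{2..m}. s j \<ge> 0"
    using n unfolding S_set_def by blast
  have i0: "0 < i" using ia a_pos by (simp add: zero_less_mult_iff)
  \<comment> \<open>Since m >= 2 and all s_j >= 0. Together with i a < t b this yields i <
    b.\<close>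
  have "t \<le> int a - 1" using ts m sum_nonneg[of "{2..m}" s] s by auto
  then have "t * int b \<le> (int a - 1) * int b" by (intro mult_right_mono) auto
  also have "\<dots> < int b * int a" using b_pos by (simp add: algebra_simps)
  finally have "i * int a < int b * int a" using ia by linarith
  then have ib: "i < int b" using a_pos by simp
  define e where "e j = (if j \<le> m then - s j else 1)" for j
  have "(\<Sum>j=2..a+1. e j) = (\<Sum>j=2..m. e j) + (int a + 1 - int m)"
    using m by (intro split_points_sum) (auto simp: e_def)
  also have "(\<Sum>j=2..m. e j) = - (\<Sum>j=2..m. s j)"
    by (simp add: e_def flip: sum_negf)
  finally have et: "(\<Sum>j=2..a+1. e j) = t" using ts by simp
  have "n = restrict (\<lambda>j. if j = 1 then t * int b - i * int a else max 0 (i - int b * e j)) {1..m}"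
    unfolding n_eq
  proof (rule restrict_ext)
    fix j assume j: "j \<in> {1..m}"
    show "(if j = 1 then t * int b - i * int a else s j * int b + i)
      = (if j = 1 then t * int b - i * int a else max 0 (i - int b * e j))"
      using j s i0 by (auto simp: e_def mult.commute)
  qed
  also have "\<dots> \<in> weierstrass_semigroup \<phi> P m"
    using et ib ia by (intro principal_tuple m) (auto simp: e_def)
  finally have nH: "n \<in> weierstrass_semigroup \<phi> P m" .
  have n1: "n 1 = t * int b - i * int a" using m by (simp add: n_eq)
  have nj: "n j = s j * int b + i" if "j \<in> {2..m}" for j using that by (auto simp: n_eq)
  have "p = n" if p: "p \<in> weierstrass_semigroup \<phi> P m" "p 1 = n 1" "tuple_le m p n" for p
  proof -
    have "(\<Sum>j=2..m. - ((p j - i) div int b)) + (int a + 1 - int m) \<le> t"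
      using p n1 ia i0 ib by (intro semigroup_order_bound m) auto
    then have ge: "(\<Sum>j=2..m. s j) \<le> (\<Sum>j=2..m. (p j - i) div int b)"
      using ts by (simp add: sum_negf)
    have le: "(p j - i) div int b \<le> s j" if "j \<in> {2..m}" for j
    proof -
      have "p j - i \<le> s j * int b" using tuple_leD[OF p(3), of j] nj[OF that] that by auto
      then have "(p j - i) div int b \<le> (s j * int b) div int b" using b_pos by (intro zdiv_mono1) auto
      then show ?thesis using b_pos by simp
    qed
    have eq: "(p j - i) div int b = s j" if j: "j \<in> {2..m}" for j
    proof (rule ccontr)
      assume "(p j - i) div int b \<noteq> s j"
      then have "(p j - i) div int b < s j" using le[OF j] by simp
      then have "(\<Sum>j=2..m. (p j - i) div int b) < (\<Sum>j=2..m. s j)"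
        using le j by (intro sum_strict_mono_ex1) auto
      then show False using ge by simp
    qed
    have ext: "p \<in> extensional {1..m}" "n \<in> extensional {1..m}"
      using p(1) nH by (auto simp: weierstrass_semigroup_def PiE_def)
    show "p = n"
    proof (rule extensionalityI[OF ext])
      fix j assume j: "j \<in> {1..m}"
      show "p j = n j"
      proof (cases "j = 1")
        case False
        then have j2: "j \<in> {2..m}" using j by auto
        have "p j - i = int b * s j + (p j - i) mod int b" using eq[OF j2] by (metis mult_div_mod_eq)
        moreover have "(p j - i) mod int b \<ge> 0" using b_pos by simp
        ultimately have "p j \<ge> n j" using nj[OF j2] by (simp add: mult.commute)
        then show ?thesis using tuple_leD[OF p(3) j] by simp
      qed (use p(2) in simp)
    qed
  qed
  then have "minimal_in m n (nabla \<phi> P m 1 n)"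
    using nH by (auto simp: minimal_in_def nabla_def)
  moreover have "n \<in> {1..m} \<rightarrow>\<^sub>E {1..}"
    unfolding n_eq
  proof (rule restrict_PiE_iff[THEN iffD2], rule ballI)
    fix j assume j: "j \<in> {1..m}"
    then have "j \<noteq> 1 \<Longrightarrow> s j * int b \<ge> 0" using s by auto
    then show "(if j = 1 then t * int b - i * int a else s j * int b + i) \<in> {1..}"
      using i0 ia by auto
  qed
  ultimately show ?thesis using m unfolding minimal_generating_set_def by auto
qed

text \<open>The ceilings of (i - n_j) / b, with ones at the remaining points, sum to at most t.
  Raising one of them until the sum is t gives a principal tuple below \<open>n\<close> with the
  same first entry; by minimality it is \<open>n\<close>.\<close>

lemma subset_S_set:
  assumes m: "2 \<le> m" "m \<le> a + 1" and n: "n \<in> minimal_generating_set \<phi> P m"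
  shows "n \<in> S_set a b m"
proof -
  have one: "1 \<in> {1..m}" using m by auto
  have nE: "n \<in> {1..m} \<rightarrow>\<^sub>E {1..}"
    and "\<exists>i\<in>{1..m}. minimal_in m n (nabla \<phi> P m i n)"
    using n by (auto simp: minimal_generating_set_def)
  then have min: "minimal_in m n (nabla \<phi> P m 1 n)"
    using minimal_in_nabla_transfer[OF m(2) _ one nE] by blast
  then have nH: "n \<in> weierstrass_semigroup \<phi> P m"
    and least: "\<And>p. p \<in> weierstrass_semigroup \<phi> P m \<Longrightarrow> p 1 = n 1 \<Longrightarrow> tuple_le m p n \<Longrightarrow> p = n"
    by (auto simp: minimal_in_def nabla_def)
  have pos: "n j \<ge> 1" if "j \<in> {1..m}" for j using nE that by (auto simp: PiE_def Pi_def)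
  \<comment> \<open>A representation of \<open>n 1 + a\<close> with coefficient \<alpha> in [0, b)
    yields i = \<alpha> + 1, which shifts the range to 0 < i <= b.\<close>
  obtain i t :: int where n1: "n 1 = t * int b - i * int a" and i: "0 < i" "i \<le> int b"
  proof -
    obtain \<alpha> \<beta> where z: "n 1 + int a = \<alpha> * (- int a) + \<beta> * int b" "0 \<le> \<alpha>" "\<alpha> < int b"
      using coprime_representation[of "- int a" "int b" "n 1 + int a"] coprime_ab b_pos by auto
    then show thesis by (intro that[of \<beta> "\<alpha> + 1"]) (auto simp: algebra_simps)
  qed
  define e where "e j = (if j \<le> m then - ((n j - i) div int b) else 1)" for j
  have sum_e: "(\<Sum>j=2..a+1. e j) = (\<Sum>j=2..m. e j) + (int a + 1 - int m)"
    using m by (intro split_points_sum) (auto simp: e_def)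
  have "(\<Sum>j=2..m. e j) = (\<Sum>j=2..m. - ((n j - i) div int b))"
    by (intro sum.cong) (auto simp: e_def)
  then have le: "(\<Sum>j=2..a+1. e j) \<le> t"
    using semigroup_order_bound[OF m nH n1 _ i] pos[OF one] sum_e by simp
  \<comment> \<open>The slack in the order bound, all of it put on the exponent at
    \<open>P 2\<close>.\<close>
  define r where "r = t - (\<Sum>j=2..a+1. e j)"
  define e' where "e' j = e j + (if j = 2 then r else 0)" for j
  have r0: "r \<ge> 0" using le by (simp add: r_def)
  have sum_e': "(\<Sum>j=2..a+1. e' j) = t"
    using m by (simp add: e'_def sum.distrib r_def)
  have e'_out: "e' j = 1" if "j \<in> {m+1..a+1}" for j
    using that m by (simp add: e'_def e_def)
  define p where "p = restrict (\<lambda>j. if j = 1 then t * int b - i * int a else max 0 (i - int b * e' j)) {1..m}"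
  have "p \<in> weierstrass_semigroup \<phi> P m"
    unfolding p_def using n1 pos[OF one] i by (intro principal_tuple m e'_out sum_e') auto
  moreover have "p 1 = n 1" using m by (simp add: p_def n1)
  moreover have "tuple_le m p n"
    unfolding tuple_le_def
  proof
    fix j assume j: "j \<in> {1..m}"
    show "p j \<le> n j"
    proof (cases "j = 1")
      case False
      have "e j = - ((n j - i) div int b)" using j by (simp add: e_def)
      then have "n j - i = (n j - i) mod int b - int b * e j"
        using mult_div_mod_eq[of "int b" "n j - i"] by simp
      moreover have "(n j - i) mod int b \<ge> 0" using b_pos by simp
      moreover have "int b * e j \<le> int b * e' j"
        using r0 by (intro mult_left_mono) (auto simp: e'_def)
      ultimately have "i - int b * e' j \<le> n j" by linarith
      then show ?thesis using pos[OF j] j False by (simp add: p_def)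
    qed (use \<open>p 1 = n 1\<close> in simp)
  qed
  ultimately have pn: "p = n" by (rule least)
  have nj: "n j = - e' j * int b + i" "e' j \<le> 0" if j: "j \<in> {2..m}" for j
  proof -
    have "n j = max 0 (i - int b * e' j)" using j by (auto simp: p_def simp flip: pn)
    then have eq: "n j = i - int b * e' j" using pos[of j] j by auto
    then show "n j = - e' j * int b + i" by (simp add: mult.commute)
    \<comment> \<open>A positive exponent would make i - b e'_j at most 0, whereas n_j >= 1.\<close>
    show "e' j \<le> 0"
    proof (rule ccontr)
      assume "\<not> e' j \<le> 0"
      then have "int b * 1 \<le> int b * e' j" by (intro mult_left_mono) auto
      moreover have "n j \<ge> 1" using pos[of j] j by auto
      ultimately show False using eq i by linarith
    qed
  qed
  have "n = restrict (\<lambda>j. if j = 1 then t * int b - i * int a else - e' j * int b + i) {1..m}"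
  proof (rule extensionalityI[of _ "{1..m}"])
    show "n \<in> extensional {1..m}" using nE by (simp add: PiE_def)
    fix j assume "j \<in> {1..m}"
    then show "n j = restrict (\<lambda>j. if j = 1 then t * int b - i * int a else - e' j * int b + i) {1..m} j"
      using nj(1)[of j] n1 by (cases "j = 1") auto
  qed simp
  moreover have "t + (\<Sum>j=2..m. - e' j) = int a + 1 - int m"
    using split_points_sum[OF m e'_out] sum_e' by (simp add: sum_negf)
  moreover have "0 < i * int a" "i * int a < t * int b"
    using i a_pos n1 pos[OF one] by auto
  ultimately show ?thesis
    using nj(2) unfolding S_set_def
    by (intro CollectI exI[of _ t] exI[of _ i] exI[of _ "\<lambda>j. - e' j"]) auto
qed

end

theorem theorem3p3:
  fixes \<phi> :: "'k::{field,finite} \<Rightarrow> 'f::field"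
    and x y :: 'f
    and f g :: "'k poly"
    and a b m :: nat
    and P :: "nat \<Rightarrow> 'f place"
  assumes deg: "degree f = a" "degree g = b"
    and coprime_ab: "coprime a b"
    and abs_irred: "absolutely_irreducible (separated_poly f g)"
    and curve: "is_function_field \<phi> x y (separated_poly f g)"
    and genus: "genus \<phi> = ereal ((real a - 1) * (real b - 1) / 2)"
    and genus_ge_1: "genus \<phi> \<ge> 1"
    and card_k: "a + 1 \<le> card (UNIV :: 'k set)"
    and points: "\<And>i. i \<in> {1..a+1} \<Longrightarrow> P i \<in> rational_places \<phi>"
    and distinct: "inj_on P {1..a+1}"
    and equiv_a: "lin_equiv \<phi> (frag_cmul (int a) (frag_of (P 1))) (\<Sum>j=2..a+1. frag_of (P j))"
    and equiv_b: "\<And>i j. i \<in> {1..a+1} \<Longrightarrow> j \<in> {1..a+1} \<Longrightarrow>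
      lin_equiv \<phi> (frag_cmul (int b) (frag_of (P i))) (frag_cmul (int b) (frag_of (P j)))"
    and m: "2 \<le> m" "m \<le> a + 1"
  shows "minimal_generating_set \<phi> P m = S_set a b m"
proof -
  have a: "a > 0" using m by simp
  \<comment> \<open>Positive genus excludes \<open>b = 0\<close>.\<close>
  have "(real a - 1) * (real b - 1) > 0" using genus genus_ge_1 by (simp add: one_ereal_def)
  then have b: "b > 0" using a by (cases b) (auto simp: zero_less_mult_iff)
  interpret field_hom \<phi> using curve by (simp add: is_function_field_def)
  interpret plane_curve \<phi> x y f g
    by unfold_locales (use curve deg a in auto)
  define gen where "gen = (int a - 1) * (int b - 1) div 2"
  \<comment> \<open>One of a - 1 and b - 1 is therefore even, so the genus is an integer.\<close>
  have "odd a \<or> odd b" using coprime_ab by (auto dest: coprime_common_divisor_nat[of a b 2])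
  then have gen: "2 * gen = (int a - 1) * (int b - 1)" by (auto simp: gen_def)
  then have "2 * real_of_int gen = (real a - 1) * (real b - 1)"
    by (metis of_int_1 of_int_diff of_int_mult of_int_numeral of_int_of_nat_eq)
  then have gen': "genus \<phi> = ereal (real_of_int gen)" using genus by simp
  have P1: "P 1 \<in> rational_places \<phi>" using points[of 1] by simp
  interpret separated_points \<phi> gen P a b
    by unfold_locales
      (use gen' gen P1 a b coprime_ab points distinct equiv_a equiv_b in \<open>auto simp: rational_places_def\<close>)
  show ?thesis using S_set_subset[OF m] subset_S_set[OF m] by blast
qed

end
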